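(* Let $m\geq 3$ and $n\geq 3$ be integers and let $d$ be an integer. Then: 1. If $m\geq 4$ is even and $n\geq 4$ is even, then $\tau_{d}(C_m\square C_n)=4d$ whenever $1\leq d\leq \frac{mn}{2}$. 2. If $m\geq 4$ is even and $n\geq 3$ is odd, then $\tau_{d}(C_m\square C_n)=4d$ whenever $1\leq d\leq \frac{mn}{2}$. 3. If $m\geq 3$ and $n\geq 3$ are both odd and $m\geq n$, then: (a) if $m\geq 5$ and $n\geq 3$, then $\tau_{1}(C_m\square C_n)=7$; (b) if $m\geq 7$ and $n\geq 3$, then $4d+2 \leq \tau_{d}(C_m\square C_n)\leq 5d+2$ whenever $2\leq d\leq \frac{m-3}{2}$; (c) if $m\geq 3$ and $n\geq 3$, then $\tau_{d}(C_m\square C_n)= 4d+2$ whenever $\frac{m-1}{2}\leq d\leq \frac{mn-1}{2}$.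
   Context: All graphs are simple, finite and undirected. A matching of a graph $G$ is a set of edges no two of which share an endpoint; a maximum matching is a matching of largest cardinality, and this cardinality is denoted $\nu(G)$. For an integer $d$ with $1\leq d\leq \nu(G)$, a $d$-transversal set of $G$ is a set $T\subseteq E(G)$ such that $|T\cap M|\geq d$ for every maximum matching $M$ of $G$; $\tau_d(G)$ denotes the minimum cardinality of a $d$-transversal set of $G$. $C_k$ is the cycle with $k$ vertices ($k\ge 3$). The Cartesian product $G\square H$ has vertex set $V(G)\times V(H)$, with $(g_1,h_1)$ and $(g_2,h_2)$ adjacent iff either $g_1=g_2$ and $h_1h_2\in E(H)$, or $g_1g_2\in E(G)$ and $h_1=h_2$. *)

theory Defs
  imports Main
begin

type_synonym 'a graph = "'a set \<times> 'a set set"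

abbreviation verts :: "'a graph \<Rightarrow> 'a set" where
  "verts G \<equiv> fst G"

abbreviation edges :: "'a graph \<Rightarrow> 'a set set" where
  "edges G \<equiv> snd G"

definition simple_graph :: "'a graph \<Rightarrow> bool" where
  "simple_graph G \<longleftrightarrow> finite (verts G) \<and> (\<forall>e\<in>edges G. e \<subseteq> verts G \<and> card e = 2)"

definition matching :: "'a graph \<Rightarrow> 'a set set \<Rightarrow> bool" where
  "matching G M \<longleftrightarrow> M \<subseteq> edges G \<and> pairwise disjnt M"

definition matching_number :: "'a graph \<Rightarrow> nat" where
  "matching_number G = Max {card M | M. matching G M}"

definition maximum_matching :: "'a graph \<Rightarrow> 'a set set \<Rightarrow> bool" where
  "maximum_matching G M \<longleftrightarrow> matching G M \<and> card M = matching_number G"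

definition transversal_set :: "nat \<Rightarrow> 'a graph \<Rightarrow> 'a set set \<Rightarrow> bool" where
  "transversal_set d G T \<longleftrightarrow>
    T \<subseteq> edges G \<and> (\<forall>M. maximum_matching G M \<longrightarrow> d \<le> card (T \<inter> M))"

(* Meaningful only for d \<le> matching_number G: beyond that no d-transversal set
   exists and the Min of the empty set is unspecified. *)
definition tau :: "nat \<Rightarrow> 'a graph \<Rightarrow> nat" where
  "tau d G = Min {card T | T. transversal_set d G T}"

(* A cycle in the usual sense only for k \<ge> 3. *)
definition cycle_graph :: "nat \<Rightarrow> nat graph" where
  "cycle_graph k = ({..<k}, {{i, (i + 1) mod k} | i. i < k})"

definition cartesian_product :: "'a graph \<Rightarrow> 'b graph \<Rightarrow> ('a \<times> 'b) graph"
    (infixl "\<box>" 70) where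
  "G \<box> H = (verts G \<times> verts H,
     {{(g1, h1), (g2, h2)} | g1 h1 g2 h2.
        g1 \<in> verts G \<and> g2 \<in> verts G \<and> h1 \<in> verts H \<and> h2 \<in> verts H \<and>
        (g1 = g2 \<and> {h1, h2} \<in> edges H \<or> {g1, g2} \<in> edges G \<and> h1 = h2)})"

lemma simple_graph_cycle_graph:
  assumes "k \<ge> 3"
  shows "simple_graph (cycle_graph k)"
proof -
  have "i \<noteq> (i + 1) mod k" if "i < k" for i
    using that assms by (cases "i + 1 = k") auto
  then have "card {i, (i + 1) mod k} = 2" if "i < k" for i
    using that by (intro card_2_iff[THEN iffD2]) blast
  moreover have "(i + 1) mod k < k" for i
    using assms by simp
  ultimately show ?thesis
    unfolding simple_graph_def cycle_graph_def by auto
qed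

lemma simple_graph_cartesian_product:
  assumes "simple_graph G" "simple_graph H"
  shows "simple_graph (G \<box> H)"
proof -
  have G: "g1 \<noteq> g2" if "{g1, g2} \<in> edges G" for g1 g2
    using that assms(1) unfolding simple_graph_def by fastforce
  have H: "h1 \<noteq> h2" if "{h1, h2} \<in> edges H" for h1 h2
    using that assms(2) unfolding simple_graph_def by fastforce
  have "e \<subseteq> verts (G \<box> H) \<and> card e = 2" if e_edge: "e \<in> edges (G \<box> H)" for e
  proof -
    obtain g1 h1 g2 h2 where e: "e = {(g1, h1), (g2, h2)}"
      and V: "g1 \<in> verts G" "g2 \<in> verts G" "h1 \<in> verts H" "h2 \<in> verts H"
      and adj: "g1 = g2 \<and> {h1, h2} \<in> edges H \<or> {g1, g2} \<in> edges G \<and> h1 = h2"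
      using e_edge unfolding cartesian_product_def snd_conv by blast
    have "(g1, h1) \<noteq> (g2, h2)"
      using adj G H by blast
    then show ?thesis
      using e V by (simp add: cartesian_product_def)
  qed
  moreover have "finite (verts (G \<box> H))"
    using assms by (simp add: simple_graph_def cartesian_product_def)
  ultimately show ?thesis
    unfolding simple_graph_def by blast
qed

end

theory Submission
  imports Defs
begin

text \<open>
The torus grid has \<open>2mn\<close> edges, and a maximum matching covers all of its \<open>mn\<close> vertices, or all but one
if \<open>mn\<close> is odd.

Upper bounds come from an independent set \<open>N\<close> of vertices (\<open>ex_independent\<close>). Each covered vertex of
\<open>N\<close> contributes its own matching edge, so the union of the stars of \<open>N\<close> is a transversal set for small \<open>d\<close>
(\<open>transversal_stars\<close>). Conversely a matching has at most \<open>card N\<close> edges in these stars, so the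
complement of the union is a transversal set for large \<open>d\<close> (\<open>transversal_off_stars\<close>). If both sides
are odd and \<open>n \<le> m\<close>, the complement has \<open>4d + 2\<close> edges, and this works down to \<open>d = (m - 1) div 2\<close>
because an independent set may wind around the torus and so contain \<open>m * (n div 2)\<close> vertices. For \<open>d = 1\<close> the stars of two adjacent
vertices, which share an edge, give \<open>7\<close>.

Lower bounds come from edge-disjoint maximum matchings. If \<open>m\<close> is even, the edges decompose into
four perfect matchings, whence \<open>4d\<close>. If both sides are odd, the grid minus a horizontal edge \<open>e\<close> and a
vertical edge \<open>f\<close> decomposes into four maximum matchings for every choice of \<open>e\<close> and \<open>f\<close>
(\<open>mixed_transversal_card\<close>). So a transversal set with edges of both directions has at least \<open>4d + 2\<close> elements,
and one with edges of a single direction has at least \<open>6d\<close>.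

The value \<open>7\<close> for \<open>d = 1\<close> requires that six edges never meet all maximum matchings if \<open>5 \<le> m\<close>
(\<open>hitting_card_ge_7\<close>). Leave out one column, pair up the remaining ones, join each pair by one
horizontal edge in a row chosen for this pair, and match everything else vertically. Only a pair of columns with at
least three of the given edges can obstruct this, and unless a single column carries three vertical
edges, at least three pairs must be obstructed in order to spoil all
choices of the column left out. Since a vertical edge counts for two pairs and a horizontal edge for one,
this needs three vertical edges, and by symmetry three horizontal ones. In this extreme case the
vertical edges lie in one column or in two adjacent ones, and a matching that shifts a column
sideways avoids all six edges (\<open>no_hitting_two_columns\<close>).
\<close>

section \<open>Matchings and transversal sets\<close>

lemma simple_graph_edgeD:
  assumes "simple_graph G" "e \<in> edges G"
  shows "e \<subseteq> verts G" "finite e" "card e = 2"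
proof -
  show "e \<subseteq> verts G" and two: "card e = 2"
    using assms by (simp_all add: simple_graph_def)
  show "finite e"
    using two by (intro card_ge_0_finite) simp
qed

lemma finite_verts: "simple_graph G \<Longrightarrow> finite (verts G)"
  by (simp add: simple_graph_def)

lemma matching_subset: "matching G M \<Longrightarrow> M \<subseteq> edges G"
  by (simp add: matching_def)

lemma finite_edges:
  assumes "simple_graph G"
  shows "finite (edges G)"
proof (rule finite_subset)
  show "edges G \<subseteq> Pow (verts G)"
    using assms by (auto simp: simple_graph_def)
  show "finite (Pow (verts G))"
    using assms by (simp add: simple_graph_def)
qed

lemma card_Union_matching:
  assumes "simple_graph G" "matching G M"
  shows "card (\<Union>M) = 2 * card M"
proof -
  have M: "finite e" "card e = 2" if "e \<in> M" for e
    using simple_graph_edgeD[OF assms(1), of e] matching_subset[OF assms(2)] that by auto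
  have "card (\<Union>M) = (\<Sum>e\<in>M. card e)"
    using assms(2) M by (intro card_Union_disjoint) (simp_all add: matching_def)
  also have "\<dots> = 2 * card M"
    using M by simp
  finally show ?thesis .
qed

lemma card_matching_le:
  assumes "simple_graph G" "matching G M"
  shows "2 * card M \<le> card (verts G)"
proof -
  have "\<Union>M \<subseteq> verts G"
    using simple_graph_edgeD(1)[OF assms(1)] matching_subset[OF assms(2)] by blast
  then have "card (\<Union>M) \<le> card (verts G)"
    using finite_verts[OF assms(1)] by (intro card_mono)
  then show ?thesis
    using card_Union_matching[OF assms] by simp
qed

lemma maximum_matching_iff:
  assumes G: "simple_graph G" and ex: "matching G M0" "card M0 = card (verts G) div 2"
  shows "maximum_matching G M \<longleftrightarrow> matching G M \<and> card M = card (verts G) div 2"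
proof -
  have bound: "card M' \<le> card (verts G) div 2" if "matching G M'" for M'
    using card_matching_le[OF G that] by simp
  have "Max {card M | M. matching G M} = card (verts G) div 2"
  proof (rule Max_eqI)
    show le: "k \<le> card (verts G) div 2" if "k \<in> {card M | M. matching G M}" for k
      using that bound by blast
    then have "{card M | M. matching G M} \<subseteq> {..card (verts G) div 2}"
      by blast
    then show "finite {card M | M. matching G M}"
      by (rule finite_subset) simp
    show "card (verts G) div 2 \<in> {card M | M. matching G M}"
      using ex(1) unfolding ex(2)[symmetric] by blast
  qed
  then show ?thesis
    by (simp add: maximum_matching_def matching_number_def)
qed

lemma finite_transversal_cards:
  assumes "simple_graph G"
  shows "finite {card T | T. transversal_set d G T}"
proof -
  have "card T \<le> card (edges G)" if "transversal_set d G T" for T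
    using that finite_edges[OF assms] by (intro card_mono) (simp_all add: transversal_set_def)
  then have "{card T | T. transversal_set d G T} \<subseteq> {..card (edges G)}"
    by blast
  then show ?thesis
    by (rule finite_subset) simp
qed

lemma tau_le:
  assumes "simple_graph G" "transversal_set d G T"
  shows "tau d G \<le> card T"
  unfolding tau_def using assms(2) finite_transversal_cards[OF assms(1), of d] by (intro Min_le) auto

lemma tau_ge:
  assumes "simple_graph G" "transversal_set d G T0"
    and "\<And>T. transversal_set d G T \<Longrightarrow> k \<le> card T"
  shows "k \<le> tau d G"
  unfolding tau_def
proof (rule Min.boundedI)
  show "finite {card T | T. transversal_set d G T}"
    using assms(1) by (rule finite_transversal_cards)
  show "{card T | T. transversal_set d G T} \<noteq> {}"
    using assms(2) by blast
qed (use assms(3) in blast)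

text \<open>The members of the family may overlap outside \<open>T\<close>: they are disjoint for the purpose of counting as soon as
no element of \<open>T\<close> lies in two of them.\<close>

lemma transversal_family_bound:
  assumes T: "transversal_set d G T" and "finite T" and "finite K"
    and M: "\<And>k. k \<in> K \<Longrightarrow> maximum_matching G (M k)"
    and disj: "\<And>k l. k \<in> K \<Longrightarrow> l \<in> K \<Longrightarrow> k \<noteq> l \<Longrightarrow> T \<inter> M k \<inter> M l = {}"
  shows "card K * d + card (T - (\<Union>k\<in>K. M k)) \<le> card T"
proof -
  have "card K * d = (\<Sum>k\<in>K. d)"
    by simp
  also have "\<dots> \<le> (\<Sum>k\<in>K. card (T \<inter> M k))"
    using T M by (intro sum_mono) (simp add: transversal_set_def)
  also have "\<dots> = card (\<Union>k\<in>K. T \<inter> M k)"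
  proof (rule card_UN_disjoint[symmetric])
    show "\<forall>k\<in>K. \<forall>l\<in>K. k \<noteq> l \<longrightarrow> T \<inter> M k \<inter> (T \<inter> M l) = {}"
      using disj by fast
  qed (use \<open>finite K\<close> \<open>finite T\<close> in auto)
  finally have "card K * d \<le> card (\<Union>k\<in>K. T \<inter> M k)" .
  moreover have "card T = card (\<Union>k\<in>K. T \<inter> M k) + card (T - (\<Union>k\<in>K. M k))"
    using card_Int_Diff[OF \<open>finite T\<close>, of "\<Union>k\<in>K. M k"] by simp
  ultimately show ?thesis
    by simp
qed

section \<open>Transversal sets from independent vertices\<close>

definition star :: "'a graph \<Rightarrow> 'a \<Rightarrow> 'a set set" where
  "star G x = {e \<in> edges G. x \<in> e}"

definition independent :: "'a graph \<Rightarrow> 'a set \<Rightarrow> bool" where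
  "independent G N \<longleftrightarrow> N \<subseteq> verts G \<and> (\<forall>e\<in>edges G. \<not> e \<subseteq> N)"

text \<open>No edge has both ends in \<open>N\<close>, so the edges of \<open>M\<close> at \<open>N\<close> correspond to the vertices of \<open>N\<close> that \<open>M\<close> covers.\<close>

lemma card_inter_stars:
  assumes G: "simple_graph G" and M: "matching G M" and N: "independent G N"
  shows "card (M \<inter> (\<Union>x\<in>N. star G x)) = card (N \<inter> \<Union>M)"
proof -
  have M_edges: "M \<subseteq> edges G"
    using M by (simp add: matching_def)
  have finM: "finite M"
    using M_edges finite_edges[OF G] by (rule finite_subset)
  have fin: "finite e" "card e = 2" "\<not> e \<subseteq> N" if "e \<in> M" for e
    using that simple_graph_edgeD[OF G] M_edges N by (auto simp: independent_def)
  have one: "card (e \<inter> N) = of_bool (e \<inter> N \<noteq> {})" if "e \<in> M" for e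
  proof -
    have "card (e \<inter> N) < card e"
      using fin[OF that] by (intro psubset_card_mono) auto
    moreover have "card (e \<inter> N) > 0" if "e \<inter> N \<noteq> {}"
      using that fin(1)[OF \<open>e \<in> M\<close>] by (simp add: card_gt_0_iff)
    ultimately show ?thesis
      using fin(2)[OF that] by (cases "e \<inter> N = {}") auto
  qed
  have "N \<inter> \<Union>M = (\<Union>e\<in>M. e \<inter> N)"
    by blast
  also have "card \<dots> = (\<Sum>e\<in>M. card (e \<inter> N))"
  proof (rule card_UN_disjoint)
    show "\<forall>e\<in>M. \<forall>e'\<in>M. e \<noteq> e' \<longrightarrow> e \<inter> N \<inter> (e' \<inter> N) = {}"
      using M unfolding matching_def pairwise_def disjnt_def by blast
  qed (use finM fin in auto)
  also have "\<dots> = (\<Sum>e\<in>M. of_bool (e \<inter> N \<noteq> {}))"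
    using one by (intro sum.cong) auto
  also have "\<dots> = card (M \<inter> {e. e \<inter> N \<noteq> {}})"
    using finM by (simp add: sum_of_bool_eq)
  also have "M \<inter> {e. e \<inter> N \<noteq> {}} = M \<inter> (\<Union>x\<in>N. star G x)"
    using M_edges by (auto simp: star_def)
  finally show ?thesis ..
qed

lemma card_stars:
  assumes G: "simple_graph G" and N: "independent G N"
    and deg: "\<And>x. x \<in> N \<Longrightarrow> card (star G x) = k"
  shows "card (\<Union>x\<in>N. star G x) = k * card N"
proof -
  have disj: "star G x \<inter> star G y = {}" if "x \<in> N" "y \<in> N" "x \<noteq> y" for x y
  proof (rule ccontr)
    assume "star G x \<inter> star G y \<noteq> {}"
    then obtain e where e: "e \<in> edges G" "{x, y} \<subseteq> e"
      by (auto simp: star_def)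
    have "card e = 2" "finite e"
      using simple_graph_edgeD[OF G e(1)] by simp_all
    then have "e = {x, y}"
      using e(2) that(3) by (metis card_2_iff card_seteq order_refl)
    then show False
      using N that e(1) by (auto simp: independent_def)
  qed
  have "card (\<Union>x\<in>N. star G x) = (\<Sum>x\<in>N. card (star G x))"
  proof (rule card_UN_disjoint)
    show "finite N"
      using N finite_verts[OF G] unfolding independent_def by (blast intro: finite_subset)
    show "\<forall>x\<in>N. finite (star G x)"
      using finite_edges[OF G] by (auto simp: star_def)
  qed (use disj in blast)
  also have "\<dots> = k * card N"
    using deg by simp
  finally show ?thesis .
qed

text \<open>A maximum matching misses at most \<open>c\<close> vertices, hence covers at least \<open>d\<close> vertices of \<open>N\<close>, each by a different edge.\<close>

lemma transversal_stars:
  assumes G: "simple_graph G" and N: "independent G N"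
    and cover: "\<And>M. maximum_matching G M \<Longrightarrow> card (verts G) \<le> 2 * card M + c"
    and card_N: "card N = d + c"
  shows "transversal_set d G (\<Union>x\<in>N. star G x)"
  unfolding transversal_set_def
proof (intro conjI allI impI)
  show "(\<Union>x\<in>N. star G x) \<subseteq> edges G"
    by (auto simp: star_def)
  fix M assume max: "maximum_matching G M"
  then have M: "matching G M"
    by (simp add: maximum_matching_def)
  have fin: "finite (verts G)" and N_sub: "N \<subseteq> verts G" and M_sub: "\<Union>M \<subseteq> verts G"
    using finite_verts[OF G] N simple_graph_edgeD(1)[OF G] matching_subset[OF M]
    by (auto simp: independent_def)
  have "card (N - \<Union>M) \<le> card (verts G - \<Union>M)"
    using fin N_sub by (intro card_mono) auto
  also have "\<dots> \<le> c"
    using cover[OF max] card_Union_matching[OF G M] card_Diff_subset[OF finite_subset[OF M_sub fin] M_sub]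
    by simp
  finally have "card (N - \<Union>M) \<le> c" .
  moreover have "card (N \<inter> \<Union>M) + card (N - \<Union>M) = card N"
    using finite_subset[OF N_sub fin] by (metis Int_Diff_Un Int_Diff_disjoint card_Un_disjoint finite_Diff finite_Int)
  ultimately have "d \<le> card (N \<inter> \<Union>M)"
    using card_N by simp
  then show "d \<le> card ((\<Union>x\<in>N. star G x) \<inter> M)"
    using card_inter_stars[OF G M N] by (simp add: Int_commute)
qed

text \<open>At most \<open>card N\<close> edges of a matching meet \<open>N\<close>, so removing the stars of \<open>N\<close> from the set of all edges loses
no more than that.\<close>

lemma transversal_off_stars:
  assumes G: "simple_graph G" and N: "independent G N"
    and card_M: "\<And>M. maximum_matching G M \<Longrightarrow> d + card N \<le> card M"
  shows "transversal_set d G (edges G - (\<Union>x\<in>N. star G x))"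
  unfolding transversal_set_def
proof (intro conjI allI impI)
  show "edges G - (\<Union>x\<in>N. star G x) \<subseteq> edges G"
    by blast
  fix M assume max: "maximum_matching G M"
  then have M: "matching G M"
    by (simp add: maximum_matching_def)
  have finM: "finite M"
    using matching_subset[OF M] finite_edges[OF G] by (rule finite_subset)
  have finN: "finite N"
    using N finite_verts[OF G] unfolding independent_def by (blast intro: finite_subset)
  have "(edges G - (\<Union>x\<in>N. star G x)) \<inter> M = M - (M \<inter> (\<Union>x\<in>N. star G x))"
    using M by (auto simp: matching_def)
  then have "card ((edges G - (\<Union>x\<in>N. star G x)) \<inter> M) = card M - card (N \<inter> \<Union>M)"
    using finM card_inter_stars[OF G M N] by (simp add: card_Diff_subset)
  moreover have "card (N \<inter> \<Union>M) \<le> card N"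
    using finN by (intro card_mono) auto
  ultimately show "d \<le> card ((edges G - (\<Union>x\<in>N. star G x)) \<inter> M)"
    using card_M[OF max] by linarith
qed

section \<open>Toroidal coordinates\<close>

text \<open>The vertices of the torus grid are addressed by integer coordinates that wrap around. The edge
\<open>hedge p i j\<close> lies in row \<open>j\<close> between the columns \<open>i\<close> and \<open>i + 1\<close>, the edge \<open>vedge p i j\<close> in column
\<open>i\<close> between the rows \<open>j\<close> and \<open>j + 1\<close>.\<close>

definition hedge :: "(int \<Rightarrow> int \<Rightarrow> 'a) \<Rightarrow> int \<Rightarrow> int \<Rightarrow> 'a set" where
  "hedge p i j = {p i j, p (i + 1) j}"

definition vedge :: "(int \<Rightarrow> int \<Rightarrow> 'a) \<Rightarrow> int \<Rightarrow> int \<Rightarrow> 'a set" where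
  "vedge p i j = {p i j, p i (j + 1)}"

abbreviation hedges :: "(int \<Rightarrow> int \<Rightarrow> 'a) \<Rightarrow> 'a set set" where
  "hedges p \<equiv> {hedge p i j | i j. True}"

abbreviation vedges :: "(int \<Rightarrow> int \<Rightarrow> 'a) \<Rightarrow> 'a set set" where
  "vedges p \<equiv> {vedge p i j | i j. True}"

text \<open>The coordinate map \<open>p\<close> is a parameter so that translations, reflections and the transposition of the torus become
changes of coordinates of one and the same graph. A symmetry argument about a set of edges
then instantiates the locale anew instead of moving the set.\<close>

locale torus =
  fixes G :: "'a graph" and m n :: int and p :: "int \<Rightarrow> int \<Rightarrow> 'a"
  assumes G: "simple_graph G" and m3: "3 \<le> m" and n3: "3 \<le> n"
    and p_eq_iff: "p i j = p i' j' \<longleftrightarrow> i mod m = i' mod m \<and> j mod n = j' mod n"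
    and verts: "verts G = {p i j | i j. True}"
    and edges: "edges G = hedges p \<union> vedges p"
begin

lemma shift_edges:
  "hedge (\<lambda>i j. p (i + a) (j + b)) i j = hedge p (i + a) (j + b)"
  "vedge (\<lambda>i j. p (i + a) (j + b)) i j = vedge p (i + a) (j + b)"
  by (simp_all add: hedge_def vedge_def algebra_simps)

lemma transpose_edges:
  "hedge (\<lambda>i j. p j i) i j = vedge p j i"
  "vedge (\<lambda>i j. p j i) i j = hedge p j i"
  by (simp_all add: hedge_def vedge_def)

lemma reflect_edges:
  "hedge (\<lambda>i j. p (c - i) j) i j = hedge p (c - i - 1) j"
  "vedge (\<lambda>i j. p (c - i) j) i j = vedge p (c - i) j"
  by (auto simp: hedge_def vedge_def algebra_simps)

lemma hedges_vedges_shift: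
  "{hedge (\<lambda>i j. p (i + a) (j + b)) i j | i j. True} = hedges p"
  "{vedge (\<lambda>i j. p (i + a) (j + b)) i j | i j. True} = vedges p"
proof -
  have "p i j = p ((i - a) + a) ((j - b) + b)" for i j
    by simp
  then have "\<exists>i' j'. hedge p i j = hedge p (i' + a) (j' + b)" "\<exists>i' j'. vedge p i j = vedge p (i' + a) (j' + b)" for i j
    by (metis diff_add_cancel)+
  then show "{hedge (\<lambda>i j. p (i + a) (j + b)) i j | i j. True} = hedges p"
    "{vedge (\<lambda>i j. p (i + a) (j + b)) i j | i j. True} = vedges p"
    unfolding shift_edges by blast+
qed

lemma hedges_vedges_reflect:
  "{hedge (\<lambda>i j. p (c - i) j) i j | i j. True} = hedges p"
  "{vedge (\<lambda>i j. p (c - i) j) i j | i j. True} = vedges p"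
proof -
  have "i = c - (c - i - 1) - 1" "i = c - (c - i)" for i
    by simp_all
  then have "\<exists>i' j'. hedge p i j = hedge p (c - i' - 1) j'" "\<exists>i' j'. vedge p i j = vedge p (c - i') j'" for i j
    by metis+
  then show "{hedge (\<lambda>i j. p (c - i) j) i j | i j. True} = hedges p"
    "{vedge (\<lambda>i j. p (c - i) j) i j | i j. True} = vedges p"
    unfolding reflect_edges by blast+
qed

lemma torus_shift: "torus G m n (\<lambda>i j. p (i + a) (j + b))"
proof
  fix i j i' j' :: int
  show "p (i + a) (j + b) = p (i' + a) (j' + b) \<longleftrightarrow> i mod m = i' mod m \<and> j mod n = j' mod n"
    by (simp add: p_eq_iff mod_eq_dvd_iff)
  have "p i j = p ((i - a) + a) ((j - b) + b)" for i j
    by simp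
  then show "verts G = {p (i + a) (j + b) | i j. True}"
    unfolding verts by blast
  show "edges G = hedges (\<lambda>i j. p (i + a) (j + b)) \<union> vedges (\<lambda>i j. p (i + a) (j + b))"
    unfolding edges hedges_vedges_shift ..
qed (rule G m3 n3)+

lemma torus_transpose: "torus G n m (\<lambda>i j. p j i)"
proof
  fix i j i' j' :: int
  show "p j i = p j' i' \<longleftrightarrow> i mod n = i' mod n \<and> j mod m = j' mod m"
    by (auto simp: p_eq_iff)
  show "verts G = {p j i | i j. True}"
    unfolding verts by blast
  show "edges G = hedges (\<lambda>i j. p j i) \<union> vedges (\<lambda>i j. p j i)"
    unfolding edges transpose_edges by blast
qed (rule G m3 n3)+

lemma torus_reflect: "torus G m n (\<lambda>i j. p (c - i) j)"
proof
  fix i j i' j' :: int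
  have "m dvd i' - i \<longleftrightarrow> m dvd i - i'"
    by (metis dvd_minus_iff minus_diff_eq)
  then show "p (c - i) j = p (c - i') j' \<longleftrightarrow> i mod m = i' mod m \<and> j mod n = j' mod n"
    by (simp add: p_eq_iff mod_eq_dvd_iff)
  have "p i j = p (c - (c - i)) j" for i j
    by simp
  then show "verts G = {p (c - i) j | i j. True}"
    unfolding verts by blast
  show "edges G = hedges (\<lambda>i j. p (c - i) j) \<union> vedges (\<lambda>i j. p (c - i) j)"
    unfolding edges hedges_vedges_reflect ..
qed (rule G m3 n3)+

lemma succ_mod_neq: "(i + 1) mod m \<noteq> i mod m" "(j + 1) mod n \<noteq> j mod n"
  using m3 n3 by (simp_all add: mod_eq_dvd_iff zdvd_not_zless)

lemma mod_add_two_neq: "(i + 2) mod m \<noteq> i mod m" "(j + 2) mod n \<noteq> j mod n"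
  using m3 n3 by (simp_all add: mod_eq_dvd_iff zdvd_not_zless)

lemma hedge_eq_iff: "hedge p i j = hedge p i' j' \<longleftrightarrow> i mod m = i' mod m \<and> j mod n = j' mod n"
proof -
  have "(i + 1) mod m \<noteq> i' mod m" if "i mod m = (i' + 1) mod m"
  proof -
    have "(i + 1) mod m = (i' + 1 + 1) mod m"
      using that by (rule mod_add_cong) simp
    then show ?thesis
      using mod_add_two_neq(1)[of i'] by (simp add: algebra_simps)
  qed
  moreover have "(i + 1) mod m = (i' + 1) mod m \<longleftrightarrow> i mod m = i' mod m"
    by (simp add: mod_eq_dvd_iff)
  ultimately show ?thesis
    by (auto simp: hedge_def doubleton_eq_iff p_eq_iff)
qed

lemma vedge_eq_iff: "vedge p i j = vedge p i' j' \<longleftrightarrow> i mod m = i' mod m \<and> j mod n = j' mod n"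
  using torus.hedge_eq_iff[OF torus_transpose, of j i j' i'] by (auto simp: hedge_def vedge_def)

lemma hedge_neq_vedge: "hedge p i j \<noteq> vedge p i' j'" "vedge p i' j' \<noteq> hedge p i j"
proof -
  show "hedge p i j \<noteq> vedge p i' j'"
    using succ_mod_neq(1)[of i] by (auto simp: hedge_def vedge_def doubleton_eq_iff p_eq_iff)
  then show "vedge p i' j' \<noteq> hedge p i j"
    by simp
qed

lemma hedge_in_edges [simp]: "hedge p i j \<in> edges G"
  and vedge_in_edges [simp]: "vedge p i j \<in> edges G"
  using edges by auto

lemma edge_at_cases:
  assumes "e \<in> edges G" "p i j \<in> e"
  shows "e \<in> {hedge p i j, hedge p (i - 1) j, vedge p i j, vedge p i (j - 1)}"
proof -
  have pred: "x mod k = (y - 1) mod k" if "y mod k = (x + 1) mod k" for x y k :: int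
    using mod_diff_cong[OF that, of 1 1] by simp
  from assms(1) consider i' j' where "e = hedge p i' j'" | i' j' where "e = vedge p i' j'"
    unfolding edges by blast
  then show ?thesis
  proof cases
    case (1 i' j')
    have "hedge p i' j' = hedge p i j" if "i mod m = i' mod m" "j mod n = j' mod n"
      using that by (simp add: hedge_eq_iff)
    moreover have "hedge p i' j' = hedge p (i - 1) j" if "i mod m = (i' + 1) mod m" "j mod n = j' mod n"
      using pred[OF that(1)] that(2) by (simp add: hedge_eq_iff)
    ultimately show ?thesis
      using assms(2) unfolding 1 hedge_def[of p i' j'] by (auto simp: p_eq_iff)
  next
    case (2 i' j')
    have "vedge p i' j' = vedge p i j" if "i mod m = i' mod m" "j mod n = j' mod n"
      using that by (simp add: vedge_eq_iff)
    moreover have "vedge p i' j' = vedge p i (j - 1)" if "i mod m = i' mod m" "j mod n = (j' + 1) mod n"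
      using pred[OF that(2)] that(1) by (simp add: vedge_eq_iff)
    ultimately show ?thesis
      using assms(2) unfolding 2 vedge_def[of p i' j'] by (auto simp: p_eq_iff)
  qed
qed

lemma star_eq: "star G (p i j) = {hedge p i j, hedge p (i - 1) j, vedge p i j, vedge p i (j - 1)}"
  using edge_at_cases[of _ i j] by (auto simp: star_def) (auto simp: hedge_def vedge_def)

lemma card_star:
  assumes "x \<in> verts G"
  shows "card (star G x) = 4"
proof -
  obtain i j where "x = p i j"
    using assms verts by auto
  moreover have "hedge p i j \<noteq> hedge p (i - 1) j" "vedge p i j \<noteq> vedge p i (j - 1)"
    using succ_mod_neq(1)[of "i - 1"] succ_mod_neq(2)[of "j - 1"]
    by (simp_all add: hedge_eq_iff vedge_eq_iff)
  ultimately show ?thesis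
    by (simp add: star_eq hedge_neq_vedge)
qed

lemma mod_box: "0 \<le> i mod m" "i mod m < m" "0 \<le> j mod n" "j mod n < n"
  using m3 n3 by simp_all

lemma card_box: "card ({0..<m} \<times> {0..<n}) = nat (m * n)"
  using m3 n3 by (simp add: nat_mult_distrib)

lemma inj_on_box:
  "inj_on (\<lambda>(i, j). p i j) ({0..<m} \<times> {0..<n})"
  "inj_on (\<lambda>(i, j). hedge p i j) ({0..<m} \<times> {0..<n})"
  "inj_on (\<lambda>(i, j). vedge p i j) ({0..<m} \<times> {0..<n})"
  by (auto simp: inj_on_def p_eq_iff hedge_eq_iff vedge_eq_iff)

lemma card_verts: "card (verts G) = nat (m * n)"
proof -
  have "p i j \<in> (\<lambda>(i, j). p i j) ` ({0..<m} \<times> {0..<n})" for i j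
    by (intro image_eqI[of _ _ "(i mod m, j mod n)"]) (simp_all add: p_eq_iff mod_box)
  then have "verts G = (\<lambda>(i, j). p i j) ` ({0..<m} \<times> {0..<n})"
    unfolding verts by auto
  then show ?thesis
    using card_image[OF inj_on_box(1)] card_box by simp
qed

lemma edges_box:
  "edges G = (\<lambda>(i, j). hedge p i j) ` ({0..<m} \<times> {0..<n}) \<union> (\<lambda>(i, j). vedge p i j) ` ({0..<m} \<times> {0..<n})"
proof -
  have "hedge p i j \<in> (\<lambda>(i, j). hedge p i j) ` ({0..<m} \<times> {0..<n})"
    "vedge p i j \<in> (\<lambda>(i, j). vedge p i j) ` ({0..<m} \<times> {0..<n})" for i j
    by (intro image_eqI[of _ _ "(i mod m, j mod n)"]; simp add: hedge_eq_iff vedge_eq_iff mod_box)+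
  then show ?thesis
    unfolding edges by auto
qed

lemma card_edges: "card (edges G) = 2 * nat (m * n)"
proof -
  have "card (edges G) = card ((\<lambda>(i, j). hedge p i j) ` ({0..<m} \<times> {0..<n})) +
      card ((\<lambda>(i, j). vedge p i j) ` ({0..<m} \<times> {0..<n}))"
    unfolding edges_box by (intro card_Un_disjoint) (auto simp: hedge_neq_vedge)
  then show ?thesis
    by (simp add: card_image[OF inj_on_box(2)] card_image[OF inj_on_box(3)] card_box)
qed

section \<open>Matchings given by residue patterns\<close>

text \<open>The predicates are evaluated at canonical residues only, so they need not be periodic.\<close>

definition pattern :: "(int \<Rightarrow> int \<Rightarrow> bool) \<Rightarrow> (int \<Rightarrow> int \<Rightarrow> bool) \<Rightarrow> 'a set set" where
  "pattern P Q = {hedge p i j | i j. P (i mod m) (j mod n)} \<union> {vedge p i j | i j. Q (i mod m) (j mod n)}"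

definition load :: "(int \<Rightarrow> int \<Rightarrow> bool) \<Rightarrow> (int \<Rightarrow> int \<Rightarrow> bool) \<Rightarrow> int \<Rightarrow> int \<Rightarrow> nat" where
  "load P Q i j = of_bool (P i j) + of_bool (P ((i - 1) mod m) j) + of_bool (Q i j) + of_bool (Q i ((j - 1) mod n))"

lemma hedge_in_pattern: "hedge p i j \<in> pattern P Q \<longleftrightarrow> P (i mod m) (j mod n)"
  unfolding pattern_def by (auto simp: hedge_eq_iff hedge_neq_vedge)

lemma vedge_in_pattern: "vedge p i j \<in> pattern P Q \<longleftrightarrow> Q (i mod m) (j mod n)"
  unfolding pattern_def by (auto simp: vedge_eq_iff hedge_neq_vedge)

lemma pattern_subset: "pattern P Q \<subseteq> edges G"
  unfolding pattern_def by auto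

text \<open>The number \<open>load P Q i j\<close> counts the selected edges at the vertex \<open>(i, j)\<close>. If it is one everywhere except
possibly at \<open>z\<close>, the selected edges form a matching that misses at most one vertex, and no matching is larger.
A pair \<open>z\<close> outside of the range of residues expresses that the matching is perfect.\<close>

lemma matching_pattern:
  assumes load: "\<And>i j. 0 \<le> i \<Longrightarrow> i < m \<Longrightarrow> 0 \<le> j \<Longrightarrow> j < n \<Longrightarrow> load P Q i j = of_bool ((i, j) \<noteq> z)"
  shows "maximum_matching G (pattern P Q)"
    and "matching G M \<and> card M = nat (m * n) div 2 \<longleftrightarrow> maximum_matching G M"
proof -
  have load': "load P Q (i mod m) (j mod n) \<le> 1" "(i mod m, j mod n) \<noteq> z \<Longrightarrow> load P Q (i mod m) (j mod n) = 1" for i j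
    using load[of "i mod m" "j mod n"] mod_box by auto
  let ?star = "\<lambda>i j. {hedge p i j, hedge p (i - 1) j, vedge p i j, vedge p i (j - 1)}"
  have unique: "e = e'"
    if "e \<in> pattern P Q" "e' \<in> pattern P Q" "e \<in> ?star i j" "e' \<in> ?star i j" for e e' i j
    using that load'(1)[of i j]
    by (auto simp: load_def hedge_in_pattern vedge_in_pattern mod_diff_left_eq split: if_splits)
  have "disjnt e e'" if e: "e \<in> pattern P Q" "e' \<in> pattern P Q" "e \<noteq> e'" for e e'
  proof (rule ccontr)
    assume "\<not> disjnt e e'"
    then obtain x where x: "x \<in> e" "x \<in> e'"
      by (auto simp: disjnt_def)
    have E: "e \<in> edges G" "e' \<in> edges G"
      using e pattern_subset by auto
    have "x \<in> verts G"
      using x(1) simple_graph_edgeD(1)[OF G E(1)] by blast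
    then obtain i j where "x = p i j"
      using verts by blast
    then show False
      using unique[OF e(1,2)] edge_at_cases[OF E(1)] edge_at_cases[OF E(2)] x e(3) by metis
  qed
  then have M: "matching G (pattern P Q)"
    using pattern_subset by (auto simp: matching_def pairwise_def)
  have covered: "p i j \<in> \<Union>(pattern P Q)" if "(i mod m, j mod n) \<noteq> z" for i j
  proof -
    have "\<exists>e\<in>?star i j. e \<in> pattern P Q"
      using load'(2)[OF that]
      by (auto simp: load_def hedge_in_pattern vedge_in_pattern mod_diff_left_eq of_bool_def split: if_splits)
    moreover have "p i j \<in> e" if "e \<in> ?star i j" for e
      using that by (auto simp: hedge_def vedge_def)
    ultimately show ?thesis
      by blast
  qed
  have "verts G \<subseteq> insert (p (fst z) (snd z)) (\<Union>(pattern P Q))"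
  proof
    fix x assume "x \<in> verts G"
    then obtain i j where "x = p i j"
      using verts by blast
    then show "x \<in> insert (p (fst z) (snd z)) (\<Union>(pattern P Q))"
      using covered[of i j] by (cases "(i mod m, j mod n) = z") (auto simp: p_eq_iff)
  qed
  moreover have fin: "finite (\<Union>(pattern P Q))"
    using finite_verts[OF G] simple_graph_edgeD(1)[OF G] pattern_subset
    by (meson Sup_least finite_subset subsetD)
  ultimately have "card (verts G) \<le> card (insert (p (fst z) (snd z)) (\<Union>(pattern P Q)))"
    by (intro card_mono) auto
  also have "\<dots> \<le> 2 * card (pattern P Q) + 1"
    using card_Union_matching[OF G M] fin by (simp add: card_insert_if)
  finally have "card (pattern P Q) = card (verts G) div 2"
    using card_matching_le[OF G M] by simp
  note eq = maximum_matching_iff[OF G M this]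
  show "maximum_matching G (pattern P Q)"
    unfolding eq using M \<open>card (pattern P Q) = card (verts G) div 2\<close> by simp
  show "matching G M \<and> card M = nat (m * n) div 2 \<longleftrightarrow> maximum_matching G M"
    unfolding eq card_verts by simp
qed

lemma pred_mod: "0 \<le> x \<Longrightarrow> x < k \<Longrightarrow> (x - 1) mod k = (if x = 0 then k - 1 else x - 1)" for x k :: int
  by (cases "x = 0") (simp_all add: zmod_minus1)

text \<open>Every second edge is taken when an odd cycle is traversed from the vertex \<open>s\<close>; the two edges at \<open>s\<close> are
the first and the last one, and both are skipped.\<close>

lemma odd_cycle_load:
  fixes k s x :: int
  assumes "odd k" "0 \<le> s" "s < k" "0 \<le> x" "x < k"
  shows "of_bool (odd ((x - s) mod k)) + of_bool (odd (((x - 1) mod k - s) mod k)) = (of_bool (x \<noteq> s) :: nat)"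
proof -
  have "k > 0"
    using assms by simp
  define t where "t = (x - s) mod k"
  have t: "0 \<le> t" "t < k"
    using \<open>k > 0\<close> by (simp_all add: t_def)
  have "((x - 1) mod k - s) mod k = (x - s - 1) mod k"
    by (simp add: mod_diff_left_eq algebra_simps)
  also have "\<dots> = (t - 1) mod k"
    by (simp add: t_def mod_diff_left_eq)
  also have "\<dots> = (if t = 0 then k - 1 else t - 1)"
    using pred_mod[OF t] .
  finally have "((x - 1) mod k - s) mod k = (if t = 0 then k - 1 else t - 1)" .
  moreover have "t = 0 \<longleftrightarrow> x = s"
    using assms by (auto simp: t_def dvd_eq_mod_eq_0[symmetric] mod_eq_dvd_iff[symmetric])
  ultimately show ?thesis
    using \<open>odd k\<close> by (auto simp: t_def[symmetric])
qed

text \<open>Colours from \<open>k\<close> on stand for edges that belong to none of the \<open>k\<close> maximum matchings; those of them in \<open>T\<close>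
improve the bound.\<close>

lemma colouring_bound:
  assumes T: "transversal_set d G T"
    and load: "\<And>c. c < k \<Longrightarrow> \<exists>z. \<forall>i j. 0 \<le> i \<longrightarrow> i < m \<longrightarrow> 0 \<le> j \<longrightarrow> j < n \<longrightarrow>
      load (\<lambda>i j. ch i j = c) (\<lambda>i j. cv i j = c) i j = of_bool ((i, j) \<noteq> z)"
  shows "k * d + card {e \<in> T. \<forall>c<k. e \<notin> pattern (\<lambda>i j. ch i j = c) (\<lambda>i j. cv i j = c)} \<le> card T"
proof -
  let ?M = "\<lambda>c::nat. pattern (\<lambda>i j. ch i j = c) (\<lambda>i j. cv i j = c)"
  have sub: "T \<subseteq> edges G"
    using T by (simp add: transversal_set_def)
  have max: "maximum_matching G (?M c)" if "c < k" for c
    using load[OF that] matching_pattern(1) by metis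
  have disj: "T \<inter> ?M c \<inter> ?M c' = {}" if "c \<noteq> c'" for c c'
    using that sub by (auto simp: edges hedge_in_pattern vedge_in_pattern)
  have "card {..<k} * d + card (T - (\<Union>c\<in>{..<k}. ?M c)) \<le> card T"
    using finite_subset[OF sub finite_edges[OF G]] max disj
    by (intro transversal_family_bound[OF T]) auto
  moreover have "T - (\<Union>c\<in>{..<k}. ?M c) = {e \<in> T. \<forall>c<k. e \<notin> ?M c}"
    by auto
  ultimately show ?thesis
    by simp
qed

section \<open>Lower bounds from edge colourings\<close>

lemma even_transversal_card:
  assumes "even m" and T: "transversal_set d G T"
  shows "4 * d \<le> card T"
proof -
  \<comment> \<open>All columns get the same colouring with \<open>0\<close>, \<open>1\<close>, \<open>2\<close>, which omits exactly one of these colours in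
    each row. As \<open>m\<close> is even, a row can alternate between its omitted colour and \<open>3\<close>.\<close>
  define ch :: "int \<Rightarrow> int \<Rightarrow> nat" where
    "ch i j = (if odd i then 3 else if j = 0 then 1
      else if j = n - 1 then (if even n then 1 else 0) else 2)" for i j
  define cv :: "int \<Rightarrow> int \<Rightarrow> nat" where
    "cv i j = (if j = n - 1 then 2 else if even j then 0 else 1)" for i j
  have "load (\<lambda>i j. ch i j = c) (\<lambda>i j. cv i j = c) i j = of_bool ((i, j) \<noteq> (-1, -1))"
    if "c < 4" "0 \<le> i" "i < m" "0 \<le> j" "j < n" for c i j
  proof -
    have "c = 0 \<or> c = 1 \<or> c = 2 \<or> c = 3"
      using that(1) by auto
    then show ?thesis
      unfolding load_def using that(2-) \<open>even m\<close> n3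
      by (elim disjE) (auto simp: pred_mod ch_def cv_def of_bool_def)
  qed
  then show ?thesis
    using colouring_bound[OF T, of 4 ch cv] by fastforce
qed

text \<open>The rows form one 2-factor of the grid and the columns another. In every unit square with corner \<open>(i, j)\<close>,
where \<open>i < m - 1\<close> and \<open>j < n - 1\<close> are even, the horizontal and the vertical edges change sides.
The squares are disjoint, and the only odd cycles of the two resulting 2-factors are the row
\<open>n - 1\<close> of the first and the column \<open>m - 1\<close> of the second. Removing one edge from each of these two cycles leaves four
maximum matchings: the colours \<open>0\<close> and \<open>1\<close> make up the first 2-factor, \<open>2\<close> and \<open>3\<close> the second, and \<open>4\<close> marks the
two removed edges.\<close>

lemma mixed_transversal_card:
  assumes odd: "odd m" "odd n" and T: "transversal_set d G T"
    and e: "hedge p a (n - 1) \<in> T" "0 \<le> a" "a < m"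
    and f: "vedge p (m - 1) b \<in> T" "0 \<le> b" "b < n"
  shows "4 * d + 2 \<le> card T"
proof -
  \<comment> \<open>The vertices missed by the four matchings are the ends of the two removed edges.\<close>
  define a' b' where "a' = (a + 1) mod m" and "b' = (b + 1) mod n"
  have bounds: "0 \<le> a'" "a' < m" "0 \<le> b'" "b' < n"
    using mod_box by (simp_all add: a'_def b'_def)
  have exclusive: "even ((x - s) mod k)" if "odd ((x - (s + 1) mod k) mod k)" "odd k" "k \<ge> 3" for x s k :: int
  proof -
    define t where "t = (x - s) mod k"
    have t: "0 \<le> t" "t < k"
      using \<open>k \<ge> 3\<close> by (simp_all add: t_def)
    have "(x - (s + 1) mod k) mod k = (t - 1) mod k"
      by (simp add: t_def mod_diff_left_eq mod_diff_right_eq algebra_simps)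
    then show ?thesis
      using that pred_mod[OF t] by (auto simp: t_def[symmetric] split: if_splits)
  qed
  define ch :: "int \<Rightarrow> int \<Rightarrow> nat" where
    "ch i j = (if j = n - 1 then if odd ((i - a) mod m) then 0 else if odd ((i - a') mod m) then 1 else 4
      else if i = m - 1 then 0 else if odd i then 1 else if j = 0 then 3 else 2)" for i j
  define cv :: "int \<Rightarrow> int \<Rightarrow> nat" where
    "cv i j = (if i = m - 1 then if odd ((j - b) mod n) then 2 else if odd ((j - b') mod n) then 3 else 4
      else if j = n - 1 then 2 else if odd j then 3 else if i = 0 then 1 else 0)" for i j
  have load: "load (\<lambda>i j. ch i j = c) (\<lambda>i j. cv i j = c) i j
      = of_bool ((i, j) \<noteq> (if c = 0 then (a, n - 1) else if c = 1 then (a', n - 1)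
          else if c = 2 then (m - 1, b) else (m - 1, b')))"
    if "c < 4" "0 \<le> i" "i < m" "0 \<le> j" "j < n" for c i j
  proof -
    have cases: "c = 0 \<or> c = 1 \<or> c = 2 \<or> c = 3"
      using that(1) by auto
    note row = odd_cycle_load[OF odd(1) e(2,3) that(2,3)] odd_cycle_load[OF odd(1) bounds(1,2) that(2,3)]
    note col = odd_cycle_load[OF odd(2) f(2,3) that(4,5)] odd_cycle_load[OF odd(2) bounds(3,4) that(4,5)]
    have ch_row: "ch x (n - 1) = 0 \<longleftrightarrow> odd ((x - a) mod m)" "ch x (n - 1) = 1 \<longleftrightarrow> odd ((x - a') mod m)"
      "ch x (n - 1) \<noteq> 2" "ch x (n - 1) \<noteq> 3" for x
      using exclusive[of x a m] odd(1) m3 by (auto simp: ch_def a'_def)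
    have cv_col: "cv (m - 1) x = 2 \<longleftrightarrow> odd ((x - b) mod n)" "cv (m - 1) x = 3 \<longleftrightarrow> odd ((x - b') mod n)"
      "cv (m - 1) x \<noteq> 0" "cv (m - 1) x \<noteq> 1" for x
      using exclusive[of x b n] odd(2) n3 by (auto simp: cv_def b'_def)
    have ch_off: "ch x y = (if x = m - 1 then 0 else if odd x then 1 else if y = 0 then 3 else 2)" if "y \<noteq> n - 1" for x y
      using that by (simp add: ch_def)
    have cv_off: "cv x y = (if y = n - 1 then 2 else if odd y then 3 else if x = 0 then 1 else 0)" if "x \<noteq> m - 1" for x y
      using that by (simp add: cv_def)
    consider "i = m - 1" "j = n - 1" | "i = m - 1" "j \<noteq> n - 1" | "i \<noteq> m - 1" "j = n - 1" | "i \<noteq> m - 1" "j \<noteq> n - 1"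
      by blast
    then show ?thesis
    proof cases
      case 1
      then show ?thesis
        unfolding load_def using cases row col m3 n3 odd
        by (elim disjE) (simp_all add: ch_row cv_col del: One_nat_def)
    next
      case 2
      have pred: "(i - 1) mod m = m - 2"
        using pred_mod[OF that(2,3)] 2 m3 by simp
      have "ch (m - 1) j = 0" "ch (m - 2) j = 1"
        using 2 odd m3 by (simp_all add: ch_off)
      then show ?thesis
        unfolding load_def pred using cases col 2
        by (elim disjE) (simp_all add: cv_col del: One_nat_def)
    next
      case 3
      have pred: "(j - 1) mod n = n - 2"
        using pred_mod[OF that(4,5)] 3 n3 by simp
      have "cv i (n - 1) = 2" "cv i (n - 2) = 3"
        using 3 odd n3 by (simp_all add: cv_off)
      then show ?thesis
        unfolding load_def pred using cases row 3
        by (elim disjE) (simp_all add: ch_row del: One_nat_def)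
    next
      case 4
      then show ?thesis
        unfolding load_def using cases m3 n3 odd that
        by (elim disjE) (auto simp: ch_off cv_off pred_mod[of i] pred_mod[of j] of_bool_def)
    qed
  qed
  let ?L = "{e \<in> T. \<forall>c<4. e \<notin> pattern (\<lambda>i j. ch i j = c) (\<lambda>i j. cv i j = c)}"
  have "4 * d + card ?L \<le> card T"
    using load by (intro colouring_bound[OF T]) blast
  moreover have "card {hedge p a (n - 1), vedge p (m - 1) b} \<le> card ?L"
  proof (rule card_mono)
    have "finite T"
      using T finite_edges[OF G] by (auto simp: transversal_set_def intro: rev_finite_subset)
    then show "finite ?L"
      by simp
    have "a' = (if a = m - 1 then 0 else a + 1)" "b' = (if b = n - 1 then 0 else b + 1)"
      using e f by (auto simp: a'_def b'_def)
    then have "ch a (n - 1) = 4" "cv (m - 1) b = 4"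
      using e f odd by (auto simp: ch_def cv_def zmod_minus1)
    then show "{hedge p a (n - 1), vedge p (m - 1) b} \<subseteq> ?L"
      using e f m3 n3 by (auto simp: hedge_in_pattern vedge_in_pattern zmod_minus1)
  qed
  ultimately show ?thesis
    by (simp add: hedge_neq_vedge)
qed

text \<open>The matching for \<open>(c, r)\<close> uses horizontal edges in row \<open>r\<close> only, every second one starting after the vertex \<open>(c, r)\<close>, and
vertical edges elsewhere. The starting points \<open>0\<close> and \<open>1\<close> and three rows give six matchings without
a common horizontal edge.\<close>

lemma horizontal_transversal_card:
  assumes odd: "odd m" "odd n" and T: "transversal_set d G T"
    and hor: "\<And>i j. vedge p i j \<notin> T"
  shows "6 * d \<le> card T"
proof -
  define K :: "(int \<times> int) set" where "K = {0, 1} \<times> {0, 1, 2}"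
  define M where "M z = pattern (\<lambda>i j. odd ((i - fst z) mod m) \<and> j = snd z) (\<lambda>i j. odd ((j - snd z) mod n))" for z
  have sub: "T \<subseteq> edges G"
    using T by (simp add: transversal_set_def)
  have K: "0 \<le> fst z" "fst z \<le> 1" "0 \<le> snd z" "snd z < n" if "z \<in> K" for z
    using that n3 by (auto simp: K_def)
  have max: "maximum_matching G (M z)" if zK: "z \<in> K" for z
    unfolding M_def
  proof (rule matching_pattern(1))
    fix i j assume ij: "0 \<le> i" "i < m" "0 \<le> j" "j < n"
    have "fst z < m"
      using K(2)[OF zK] m3 by simp
    note odd_cycle_load[OF odd(1) K(1)[OF zK] this ij(1,2)] odd_cycle_load[OF odd(2) K(3,4)[OF zK] ij(3,4)]
    then show "load (\<lambda>i j. odd ((i - fst z) mod m) \<and> j = snd z) (\<lambda>i j. odd ((j - snd z) mod n)) i j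
        = of_bool ((i, j) \<noteq> z)"
      by (cases "j = snd z") (auto simp: load_def prod_eq_iff)
  qed
  have disj: "T \<inter> M z \<inter> M z' = {}" if "z \<in> K" "z' \<in> K" "z \<noteq> z'" for z z'
  proof -
    have "snd z \<noteq> snd z' \<or> fst z = 0 \<and> fst z' = 1 \<or> fst z = 1 \<and> fst z' = 0"
      using that by (auto simp: K_def)
    moreover have "\<not> (odd (i mod m) \<and> odd ((i - 1) mod m))" for i
      using pred_mod[of "i mod m" m] mod_box by (auto simp: mod_diff_left_eq split: if_splits)
    ultimately have "\<not> (hedge p i j \<in> M z \<and> hedge p i j \<in> M z')" for i j
      unfolding M_def hedge_in_pattern mod_diff_left_eq by (elim disjE) auto
    then show ?thesis
      using sub hor unfolding edges by blast
  qed
  have "finite T"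
    using sub finite_edges[OF G] by (rule finite_subset)
  then have "card K * d + card (T - (\<Union>z\<in>K. M z)) \<le> card T"
    by (rule transversal_family_bound[OF T _ _ max disj]) (simp_all add: K_def)
  then show ?thesis
    by (simp add: K_def)
qed

lemma odd_transversal_card:
  assumes odd: "odd m" "odd n" and T: "transversal_set d G T" and "d \<ge> 1"
  shows "4 * d + 2 \<le> card T"
proof -
  have six: "4 * d + 2 \<le> 6 * d"
    using \<open>d \<ge> 1\<close> by simp
  consider i j i' j' where "hedge p i j \<in> T" "vedge p i' j' \<in> T"
    | "\<And>i j. vedge p i j \<notin> T" | "\<And>i j. hedge p i j \<notin> T"
    by blast
  then show ?thesis
  proof cases
    case (1 i j i' j')
    \<comment> \<open>Coordinates in which the horizontal edge lies in the last row and the vertical one in the last column.\<close>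
    let ?\<alpha> = "i' - (m - 1)" and ?\<beta> = "j - (n - 1)"
    interpret shifted: torus G m n "\<lambda>i j. p (i + ?\<alpha>) (j + ?\<beta>)"
      by (rule torus_shift)
    have "hedge p ((i - ?\<alpha>) mod m + ?\<alpha>) j = hedge p i j" "vedge p i' ((j' - ?\<beta>) mod n + ?\<beta>) = vedge p i' j'"
      unfolding hedge_eq_iff vedge_eq_iff mod_add_left_eq by simp_all
    then show ?thesis
      using 1 mod_box
      by (intro shifted.mixed_transversal_card[OF odd T, of "(i - ?\<alpha>) mod m" "(j' - ?\<beta>) mod n"])
        (simp_all add: shift_edges)
  next
    case 2
    show ?thesis
      using horizontal_transversal_card[OF odd T 2] six by simp
  next
    case 3
    interpret transposed: torus G n m "\<lambda>i j. p j i"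
      by (rule torus_transpose)
    show ?thesis
      using transposed.horizontal_transversal_card[OF odd(2,1) T] 3 six by (simp add: transpose_edges)
  qed
qed

section \<open>Independent sets and upper bounds\<close>

lemma dvd_small_eq_0: "k dvd z \<Longrightarrow> \<bar>z\<bar> < k \<Longrightarrow> z = 0" for k z :: int
  by (rule ccontr) (use dvd_imp_le_int[of z k] in linarith)

lemma independent_subset: "independent G N \<Longrightarrow> N' \<subseteq> N \<Longrightarrow> independent G N'"
  unfolding independent_def by blast

text \<open>Column \<open>i\<close> contains every second vertex upwards from row \<open>g i\<close>. Since \<open>g\<close> moves by one between neighbouring
columns, two adjacent members of \<open>N\<close> would lead to an odd number that is divisible by \<open>n\<close> and yet smaller than \<open>n\<close> in
absolute value.\<close>

lemma independent_walk:
  fixes g :: "int \<Rightarrow> int"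
  assumes step: "\<And>i. 0 \<le> i \<Longrightarrow> i < m \<Longrightarrow> \<bar>g (i + 1) - g i\<bar> = 1" and closed: "n dvd g m - g 0"
  defines "N \<equiv> (\<lambda>(i, k). p i (g i + 2 * k)) ` ({0..<m} \<times> {0..<n div 2})"
  shows "independent G N" "card N = nat m * nat (n div 2)"
proof -
  have inj: "inj_on (\<lambda>(i, k). p i (g i + 2 * k)) ({0..<m} \<times> {0..<n div 2})"
  proof (rule inj_onI, clarify)
    fix i k i' k'
    assume r: "i \<in> {0..<m}" "k \<in> {0..<n div 2}" "i' \<in> {0..<m}" "k' \<in> {0..<n div 2}"
      and eq: "p i (g i + 2 * k) = p i' (g i' + 2 * k')"
    have "i = i'"
      using eq r by (simp add: p_eq_iff)
    then have "n dvd 2 * k - 2 * k'"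
      using eq by (simp add: p_eq_iff mod_eq_dvd_iff)
    then have "2 * k - 2 * k' = 0"
      using r by (intro dvd_small_eq_0[of n]) (assumption, simp, linarith)
    then show "i = i' \<and> k = k'"
      using \<open>i = i'\<close> by simp
  qed
  show "card N = nat m * nat (n div 2)"
    unfolding N_def by (simp add: card_image[OF inj])
  have close: False
    if "n dvd (2 * k' - 2 * k) + s" "\<bar>s\<bar> = 1" "k \<in> {0..<n div 2}" "k' \<in> {0..<n div 2}" for k k' s
  proof -
    have "(2 * k' - 2 * k) + s = 0"
      using that(2-) by (intro dvd_small_eq_0[OF that(1)]) (simp, linarith)
    then show False
      using that(2) by presburger
  qed
  have N_E: "\<exists>i k. i \<in> {0..<m} \<and> k \<in> {0..<n div 2} \<and> v = p i (g i + 2 * k)" if "v \<in> N" for v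
    using that unfolding N_def by auto blast
  have "\<not> hedge p x y \<subseteq> N" for x y
  proof
    assume "hedge p x y \<subseteq> N"
    then obtain i k i' k' where r: "i \<in> {0..<m}" "k \<in> {0..<n div 2}" "i' \<in> {0..<m}" "k' \<in> {0..<n div 2}"
      and eq: "p x y = p i (g i + 2 * k)" "p (x + 1) y = p i' (g i' + 2 * k')"
      unfolding hedge_def using N_E by (metis insert_subset)
    have "i' mod m = (i + 1) mod m"
      using eq mod_add_cong[of x m i 1 1] by (simp add: p_eq_iff)
    then have "i' = (if i + 1 = m then 0 else i + 1)"
      using r by auto
    moreover have "n dvd g 0 - g m"
      using closed by (metis dvd_minus_iff minus_diff_eq)
    ultimately have "n dvd g i' - g (i + 1)"
      by (cases "i + 1 = m") simp_all
    moreover have "n dvd (g i' + 2 * k') - (g i + 2 * k)"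
    proof -
      have "(g i' + 2 * k') mod n = (g i + 2 * k) mod n"
        using eq by (simp add: p_eq_iff)
      then show ?thesis
        by (simp only: mod_eq_dvd_iff)
    qed
    ultimately have "n dvd (g i' + 2 * k') - (g i + 2 * k) - (g i' - g (i + 1))"
      by (rule dvd_diff[rotated])
    then show False
      using close[of k' k "g (i + 1) - g i"] step[of i] r by (simp add: algebra_simps)
  qed
  moreover have "\<not> vedge p x y \<subseteq> N" for x y
  proof
    assume "vedge p x y \<subseteq> N"
    then obtain i k i' k' where r: "i \<in> {0..<m}" "k \<in> {0..<n div 2}" "i' \<in> {0..<m}" "k' \<in> {0..<n div 2}"
      and eq: "p x y = p i (g i + 2 * k)" "p x (y + 1) = p i' (g i' + 2 * k')"
      unfolding vedge_def using N_E by (metis insert_subset)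
    have "i = i'"
      using eq r by (simp add: p_eq_iff)
    have "(g i + 2 * k + 1) mod n = (g i + 2 * k') mod n"
      using eq mod_add_cong[of y n "g i + 2 * k" 1 1] \<open>i = i'\<close> by (simp add: p_eq_iff)
    then have "n dvd (g i + 2 * k + 1) - (g i + 2 * k')"
      by (simp add: mod_eq_dvd_iff)
    then show False
      using close[of k k' 1] r by (simp add: algebra_simps)
  qed
  moreover have "N \<subseteq> verts G"
    unfolding N_def verts by auto
  ultimately show "independent G N"
    unfolding independent_def edges by blast
qed

lemma ex_independent:
  assumes "even m \<or> odd m \<and> odd n \<and> n \<le> m" and "k \<le> nat m * nat (n div 2)"
  obtains N where "independent G N" "card N = k"
proof -
  obtain g :: "int \<Rightarrow> int" where g: "\<And>i. 0 \<le> i \<Longrightarrow> i < m \<Longrightarrow> \<bar>g (i + 1) - g i\<bar> = 1" "n dvd g m - g 0"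
  proof (cases "even m")
    case True
    have "\<bar>(i + 1) mod 2 - i mod 2\<bar> = 1" for i :: int
      by presburger
    then show ?thesis
      using that[of "\<lambda>i. i mod 2"] True by simp
  next
    case False
    \<comment> \<open>The walk goes around the cycle of length \<open>n\<close> once and spends the remaining even number \<open>m - n\<close> of steps going
      back and forth; this is where \<open>n \<le> m\<close> enters.\<close>
    define g where "g i = (if i \<le> n then i else n + (i - n) mod 2)" for i
    have "\<bar>(x + 1) mod 2 - x mod 2\<bar> = 1" for x :: int
      by presburger
    from this[of "i - n" for i] have "\<bar>g (i + 1) - g i\<bar> = 1" for i
      unfolding g_def by (cases "i < n"; cases "i = n") (simp_all add: diff_add_eq)
    moreover have "g m = n" "g 0 = 0"
      using False assms(1) n3 by (auto simp: g_def)
    ultimately show ?thesis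
      using that[of g] by simp
  qed
  show ?thesis
  proof -
    let ?N = "(\<lambda>(i, k). p i (g i + 2 * k)) ` ({0..<m} \<times> {0..<n div 2})"
    have N: "independent G ?N" "card ?N = nat m * nat (n div 2)"
      using independent_walk[OF g] by blast+
    then obtain N' where "N' \<subseteq> ?N" "card N' = k"
      using obtain_subset_with_card_n[of k ?N] assms(2) by auto
    then show thesis
      using that independent_subset[OF N(1)] by blast
  qed
qed

lemma maximum_matching_card:
  assumes "even m \<or> odd m \<and> odd n"
  shows "maximum_matching G M \<longleftrightarrow> matching G M \<and> card M = nat (m * n) div 2"
proof (cases "even m")
  case True
  show ?thesis
    by (rule matching_pattern(2)[of "\<lambda>i j. odd i" "\<lambda>i j. False" "(-1, -1)", symmetric])
      (use True in \<open>auto simp: load_def pred_mod\<close>)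
next
  case False
  then have odd: "odd m" "odd n"
    using assms by auto
  show ?thesis
  proof (rule matching_pattern(2)[of "\<lambda>i j. odd i \<and> j = 0" "\<lambda>i j. odd j" "(0, 0)", symmetric])
    fix i j assume "0 \<le> i" "i < m" "0 \<le> j" "j < n"
    then show "load (\<lambda>i j. odd i \<and> j = 0) (\<lambda>i j. odd j) i j = of_bool ((i, j) \<noteq> (0, 0))"
      using odd m3 n3 by (auto simp: load_def pred_mod)
  qed
qed

lemma stars_bound:
  assumes "even m \<or> odd m \<and> odd n" and N: "independent G N" "card N = d + nat (m * n) mod 2"
  obtains T where "transversal_set d G T" "card T = 4 * card N"
proof
  show "transversal_set d G (\<Union>x\<in>N. star G x)"
    using maximum_matching_card[OF assms(1)] N(2)
    by (intro transversal_stars[OF G N(1)]) (auto simp: card_verts)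
  show "card (\<Union>x\<in>N. star G x) = 4 * card N"
    using N(1) card_star by (intro card_stars[OF G N(1)]) (auto simp: independent_def)
qed

lemma off_stars_bound:
  assumes "even m \<or> odd m \<and> odd n" and N: "independent G N" "d + card N = nat (m * n) div 2"
  obtains T where "transversal_set d G T" "card T = 4 * d + 2 * (nat (m * n) mod 2)"
proof
  show "transversal_set d G (edges G - (\<Union>x\<in>N. star G x))"
    using maximum_matching_card[OF assms(1)] N(2)
    by (intro transversal_off_stars[OF G N(1)]) simp
  have arith: "2 * x - 4 * k = 4 * d + 2 * (x mod 2)" if "d + k = x div 2" for d k x :: nat
    using that by presburger
  have stars_sub: "(\<Union>x\<in>N. star G x) \<subseteq> edges G"
    by (auto simp: star_def)
  have "card (\<Union>x\<in>N. star G x) = 4 * card N"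
    using N(1) card_star by (intro card_stars[OF G N(1)]) (auto simp: independent_def)
  then have "card (edges G - (\<Union>x\<in>N. star G x)) = 2 * nat (m * n) - 4 * card N"
    using finite_subset[OF stars_sub finite_edges[OF G]] card_edges stars_sub
    by (simp add: card_Diff_subset)
  then show "card (edges G - (\<Union>x\<in>N. star G x)) = 4 * d + 2 * (nat (m * n) mod 2)"
    using N(2) arith[of d "card N"] by simp
qed

text \<open>One of \<open>d\<close> and \<open>nat (m * n) div 2 - d\<close> is at most the size of a large independent set, so either the stars of such a set or
the complement of the stars is small enough.\<close>

lemma tau_even:
  assumes "even m" "d \<le> nat (m * n) div 2"
  shows "tau d G = 4 * d"
proof -
  obtain T where T: "transversal_set d G T" "card T = 4 * d"
  proof -
    let ?K = "nat m * nat (n div 2)"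
    have parity: "nat (m * n) mod 2 = 0"
      using assms(1) m3 n3 by (simp add: nat_mult_distrib even_nat_iff flip: even_iff_mod_2_eq_zero)
    have "nat n \<le> 4 * nat (n div 2)"
      using n3 by linarith
    then have "nat m * nat n \<le> nat m * (4 * nat (n div 2))"
      by (rule mult_le_mono2)
    then have "nat (m * n) \<le> 4 * ?K"
      using m3 by (simp add: nat_mult_distrib)
    then consider "d \<le> ?K" | "nat (m * n) div 2 - d \<le> ?K"
      by linarith
    then show ?thesis
    proof cases
      case 1
      then obtain N where "independent G N" "card N = d"
        using ex_independent assms(1) by blast
      then show ?thesis
        using stars_bound[of N d] that assms(1) parity by auto
    next
      case 2
      then obtain N where "independent G N" "card N = nat (m * n) div 2 - d"
        using ex_independent assms(1) by blast
      then show ?thesis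
        using off_stars_bound[of N d] that assms parity by auto
    qed
  qed
  show ?thesis
  proof (rule antisym)
    show "tau d G \<le> 4 * d"
      using tau_le[OF G T(1)] T(2) by simp
    show "4 * d \<le> tau d G"
      using even_transversal_card[OF assms(1)] by (rule tau_ge[OF G T(1)])
  qed
qed

text \<open>A maximum matching misses only one vertex, so it covers one of any two adjacent vertices.\<close>

lemma adjacent_stars_bound:
  assumes "odd m" "odd n"
  obtains T where "transversal_set 1 G T" "card T \<le> 7"
proof
  let ?T = "star G (p 0 0) \<union> star G (p 1 0)"
  show "transversal_set 1 G ?T"
    unfolding transversal_set_def
  proof (intro conjI allI impI)
    show "?T \<subseteq> edges G"
      by (auto simp: star_def)
    fix M assume max: "maximum_matching G M"
    then have M: "matching G M" "card M = nat (m * n) div 2"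
      using maximum_matching_card assms by auto
    have "\<Union>M \<subseteq> verts G"
      using matching_subset[OF M(1)] simple_graph_edgeD(1)[OF G] by blast
    have "\<Union>M \<inter> {p 0 0, p 1 0} \<noteq> {}"
    proof
      assume disj: "\<Union>M \<inter> {p 0 0, p 1 0} = {}"
      have "card (\<Union>M) + card {p 0 0, p 1 0} = card (\<Union>M \<union> {p 0 0, p 1 0})"
        using finite_subset[OF \<open>\<Union>M \<subseteq> verts G\<close> finite_verts[OF G]] disj
        by (intro card_Un_disjoint[symmetric]) simp_all
      also have "\<dots> \<le> card (verts G)"
        using \<open>\<Union>M \<subseteq> verts G\<close> finite_verts[OF G] verts by (intro card_mono) auto
      finally have "2 * (nat (m * n) div 2) + card {p 0 0, p 1 0} \<le> nat (m * n)"
        using card_Union_matching[OF G M(1)] M(2) card_verts by simp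
      moreover have "p 0 0 \<noteq> p 1 0"
        using m3 by (simp add: p_eq_iff)
      ultimately show False
        by simp
    qed
    then have "?T \<inter> M \<noteq> {}"
      using matching_subset[OF M(1)] by (auto simp: star_def)
    moreover have "finite (?T \<inter> M)"
      using finite_subset[OF matching_subset[OF M(1)] finite_edges[OF G]] by simp
    ultimately show "1 \<le> card (?T \<inter> M)"
      by (simp add: card_gt_0_iff Suc_le_eq)
  qed
  have fin: "finite (star G x)" for x
    using finite_edges[OF G] by (simp add: star_def)
  have "hedge p 0 0 \<in> star G (p 0 0) \<inter> star G (p 1 0)"
    by (simp add: star_def) (simp add: hedge_def)
  then have "card (star G (p 0 0) \<inter> star G (p 1 0)) \<ge> 1"
    using fin by (metis One_nat_def Suc_leI card_gt_0_iff empty_iff finite_Int)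
  moreover have "card (star G (p 0 0)) = 4" "card (star G (p 1 0)) = 4"
    using verts by (auto intro!: card_star)
  ultimately show "card ?T \<le> 7"
    using card_Un_Int[OF fin fin, of "p 0 0" "p 1 0"] by simp
qed

end

section \<open>Six edges miss some maximum matching\<close>

text \<open>These numbers count the edges of \<open>T\<close> between the columns \<open>i\<close> and \<open>i + 1\<close> and within column \<open>i\<close>, respectively.\<close>

definition hcount :: "(int \<Rightarrow> int \<Rightarrow> 'a) \<Rightarrow> int \<Rightarrow> 'a set set \<Rightarrow> int \<Rightarrow> nat" where
  "hcount p n T i = card {j \<in> {0..<n}. hedge p i j \<in> T}"

definition vcount :: "(int \<Rightarrow> int \<Rightarrow> 'a) \<Rightarrow> int \<Rightarrow> 'a set set \<Rightarrow> int \<Rightarrow> nat" where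
  "vcount p n T i = card {j \<in> {0..<n}. vedge p i j \<in> T}"

definition hitting :: "'a graph \<Rightarrow> 'a set set \<Rightarrow> bool" where
  "hitting G T \<longleftrightarrow> (\<forall>M. maximum_matching G M \<longrightarrow> T \<inter> M \<noteq> {})"

context torus
begin

lemma counts_reparametrized:
  "hcount (\<lambda>i. p (i + a)) n T i = hcount p n T (i + a)"
  "vcount (\<lambda>i. p (i + a)) n T i = vcount p n T (i + a)"
  "hcount (\<lambda>i. p (c - i)) n T i = hcount p n T (c - i - 1)"
  "vcount (\<lambda>i. p (c - i)) n T i = vcount p n T (c - i)"
proof -
  have "hedge (\<lambda>i. p (i + a)) i j = hedge p (i + a) j" "vedge (\<lambda>i. p (i + a)) i j = vedge p (i + a) j"
    "hedge (\<lambda>i. p (c - i)) i j = hedge p (c - i - 1) j" "vedge (\<lambda>i. p (c - i)) i j = vedge p (c - i) j" for j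
    by (auto simp: hedge_def vedge_def algebra_simps)
  then show "hcount (\<lambda>i. p (i + a)) n T i = hcount p n T (i + a)"
    "vcount (\<lambda>i. p (i + a)) n T i = vcount p n T (i + a)"
    "hcount (\<lambda>i. p (c - i)) n T i = hcount p n T (c - i - 1)"
    "vcount (\<lambda>i. p (c - i)) n T i = vcount p n T (c - i)"
    by (simp_all add: hcount_def vcount_def)
qed

lemma torus_shift_col: "torus G m n (\<lambda>i. p (i + a))"
  using torus_shift[of a 0] by simp

lemma counts_mod: "hcount p n T (i mod m) = hcount p n T i" "vcount p n T (i mod m) = vcount p n T i"
proof -
  have "hedge p (i mod m) j = hedge p i j" "vedge p (i mod m) j = vedge p i j" for j
    by (simp_all add: hedge_eq_iff vedge_eq_iff)
  then show "hcount p n T (i mod m) = hcount p n T i" "vcount p n T (i mod m) = vcount p n T i"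
    by (simp_all add: hcount_def vcount_def)
qed

lemma hedge_mod: "hedge p (i mod m) (j mod n) = hedge p i j"
  and vedge_mod: "vedge p (i mod m) (j mod n) = vedge p i j"
  by (simp_all add: hedge_eq_iff vedge_eq_iff)

lemma finite_range_Collect: "finite {j \<in> {0..<n}. R j}"
  by (rule finite_subset[of _ "{0..<n}"]) auto

lemma counts_pos:
  "hedge p i j \<in> T \<Longrightarrow> hcount p n T i > 0"
  "vedge p i j \<in> T \<Longrightarrow> vcount p n T i > 0"
proof -
  have mod: "hedge p i (j mod n) = hedge p i j" "vedge p i (j mod n) = vedge p i j" "j mod n \<in> {0..<n}"
    using mod_box by (simp_all add: hedge_eq_iff vedge_eq_iff)
  show "hcount p n T i > 0" if "hedge p i j \<in> T"
  proof -
    have "j mod n \<in> {j \<in> {0..<n}. hedge p i j \<in> T}"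
      using that mod by simp
    then show ?thesis
      unfolding hcount_def card_gt_0_iff by (intro conjI finite_range_Collect) blast
  qed
  show "vcount p n T i > 0" if "vedge p i j \<in> T"
  proof -
    have "j mod n \<in> {j \<in> {0..<n}. vedge p i j \<in> T}"
      using that mod by simp
    then show ?thesis
      unfolding vcount_def card_gt_0_iff by (intro conjI finite_range_Collect) blast
  qed
qed

lemma free_row:
  assumes "hcount p n T i < nat n"
  obtains r where "0 \<le> r" "r < n" "hedge p i r \<notin> T"
proof (rule ccontr)
  assume "\<not> thesis"
  then have "{j \<in> {0..<n}. hedge p i j \<in> T} = {0..<n}"
    using that by force
  then show False
    using assms by (simp add: hcount_def)
qed

lemma sum_counts:
  "card (T \<inter> hedges p) = (\<Sum>i\<in>{0..<m}. hcount p n T i)"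
  "card (T \<inter> vedges p) = (\<Sum>i\<in>{0..<m}. vcount p n T i)"
proof -
  have "card (T \<inter> {f i j | i j. True}) = (\<Sum>i\<in>{0..<m}. card {j \<in> {0..<n}. f i j \<in> T})"
    if inj: "inj_on (\<lambda>(i, j). f i j) ({0..<m} \<times> {0..<n})"
      and f_mod: "\<And>i j. f (i mod m) (j mod n) = f i j" for f :: "int \<Rightarrow> int \<Rightarrow> 'a set"
  proof -
    let ?S = "SIGMA i:{0..<m}. {j \<in> {0..<n}. f i j \<in> T}"
    have "T \<inter> {f i j | i j. True} = (\<lambda>(i, j). f i j) ` ?S"
    proof (intro equalityI subsetI)
      fix e assume "e \<in> T \<inter> {f i j | i j. True}"
      then obtain i j where "e = f i j" "f i j \<in> T"
        by auto
      then show "e \<in> (\<lambda>(i, j). f i j) ` ?S"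
        using f_mod[of i j] mod_box by (intro image_eqI[of _ _ "(i mod m, j mod n)"]) simp_all
    qed auto
    moreover have "inj_on (\<lambda>(i, j). f i j) ?S"
      using inj by (rule inj_on_subset) auto
    ultimately have "card (T \<inter> {f i j | i j. True}) = card ?S"
      by (simp only: card_image)
    also have "\<dots> = (\<Sum>i\<in>{0..<m}. card {j \<in> {0..<n}. f i j \<in> T})"
      by (intro card_SigmaI ballI finite_range_Collect) simp
    finally show ?thesis .
  qed
  from this[OF inj_on_box(2) hedge_mod] this[OF inj_on_box(3) vedge_mod]
  show "card (T \<inter> hedges p) = (\<Sum>i\<in>{0..<m}. hcount p n T i)"
    "card (T \<inter> vedges p) = (\<Sum>i\<in>{0..<m}. vcount p n T i)"
    by (simp_all only: hcount_def vcount_def)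
qed

lemma hittingE:
  assumes "hitting G T" "maximum_matching G (pattern P Q)"
  obtains i j where "0 \<le> i" "i < m" "0 \<le> j" "j < n" "P i j" "hedge p i j \<in> T"
    | i j where "0 \<le> i" "i < m" "0 \<le> j" "j < n" "Q i j" "vedge p i j \<in> T"
proof -
  obtain e where e: "e \<in> T" "e \<in> pattern P Q"
    using assms by (auto simp: hitting_def)
  then consider i j where "e = hedge p i j" "P (i mod m) (j mod n)" | i j where "e = vedge p i j" "Q (i mod m) (j mod n)"
    unfolding pattern_def by blast
  then show thesis
  proof cases
    case (1 i j)
    then have "hedge p (i mod m) (j mod n) \<in> T"
      using e(1) by (simp only: hedge_mod)
    then show ?thesis
      using that(1)[of "i mod m" "j mod n"] 1 mod_box by simp
  next
    case (2 i j)
    then have "vedge p (i mod m) (j mod n) \<in> T"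
      using e(1) by (simp only: vedge_mod)
    then show ?thesis
      using that(2)[of "i mod m" "j mod n"] 2 mod_box by simp
  qed
qed

text \<open>An odd column without its vertex in row \<open>r\<close> is a path with a unique perfect matching, which takes every second edge from row
\<open>r + 1\<close> on. The predicate says that this matching avoids \<open>T\<close>.\<close>

definition row_free :: "'a set set \<Rightarrow> int \<Rightarrow> int \<Rightarrow> bool" where
  "row_free T i r \<longleftrightarrow> (\<forall>j\<in>{0..<n}. odd ((j - r) mod n) \<longrightarrow> vedge p i j \<notin> T)"

text \<open>A vertical edge belongs to the matchings that leave out row \<open>r\<close> for exactly \<open>(n - 1) div 2\<close> values of \<open>r\<close>.\<close>

lemma blocked_rows_card:
  assumes "odd n"
  shows "card {r \<in> {0..<n}. \<not> row_free T i r} \<le> vcount p n T i * nat ((n - 1) div 2)"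
proof -
  let ?V = "{j \<in> {0..<n}. vedge p i j \<in> T}" and ?K = "nat ((n - 1) div 2)"
  let ?kill = "\<lambda>j. {r \<in> {0..<n}. odd ((j - r) mod n)}"
  have "card (?kill j) \<le> ?K" for j
  proof -
    have "inj_on (\<lambda>r. (j - r) mod n) (?kill j)"
    proof (rule inj_onI)
      fix r r' assume r: "r \<in> ?kill j" "r' \<in> ?kill j" and "(j - r) mod n = (j - r') mod n"
      then have "n dvd r' - r"
        by (simp add: mod_eq_dvd_iff)
      then have "r' - r = 0"
        using r by (intro dvd_small_eq_0[of n]) (assumption, auto)
      then show "r = r'"
        by simp
    qed
    moreover have "(\<lambda>r. (j - r) mod n) ` ?kill j \<subseteq> (\<lambda>x. 2 * x + 1) ` {0..<(n - 1) div 2}"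
    proof (clarify)
      fix r assume "odd ((j - r) mod n)"
      moreover have "t \<in> (\<lambda>x. 2 * x + 1) ` {0..<(n - 1) div 2}" if "odd t" "0 \<le> t" "t < n" for t
      proof
        show "t = 2 * (t div 2) + 1"
          using \<open>odd t\<close> by presburger
        have "0 \<le> t div 2" "t div 2 < (n - 1) div 2"
          using that \<open>odd n\<close> by presburger+
        then show "t div 2 \<in> {0..<(n - 1) div 2}"
          by simp
      qed
      ultimately show "(j - r) mod n \<in> (\<lambda>x. 2 * x + 1) ` {0..<(n - 1) div 2}"
        using mod_box by blast
    qed
    then have "card ((\<lambda>r. (j - r) mod n) ` ?kill j) \<le> card ((\<lambda>x. 2 * x + 1) ` {0..<(n - 1) div 2})"
      by (intro card_mono) simp_all
    moreover have "card ((\<lambda>x::int. 2 * x + 1) ` {0..<(n - 1) div 2}) \<le> ?K"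
      using card_image_le[of "{0..<(n - 1) div 2}" "\<lambda>x. 2 * x + 1"] by simp
    ultimately show ?thesis
      by (simp add: card_image)
  qed
  then have "(\<Sum>j\<in>?V. card (?kill j)) \<le> card ?V * ?K"
    using sum_bounded_above[of ?V "\<lambda>j. card (?kill j)" ?K] by simp
  moreover have "card (\<Union>j\<in>?V. ?kill j) \<le> (\<Sum>j\<in>?V. card (?kill j))"
    by (intro card_UN_le finite_range_Collect)
  moreover have "{r \<in> {0..<n}. \<not> row_free T i r} = (\<Union>j\<in>?V. ?kill j)"
    by (auto simp: row_free_def)
  ultimately show ?thesis
    by (simp add: vcount_def)
qed

text \<open>The row \<open>r\<close> allows the columns \<open>i\<close> and \<open>i + 1\<close> to be matched by the edge between them in row \<open>r\<close> and
vertical edges. Each edge of \<open>T\<close> spoils at most \<open>(n - 1) div 2\<close> rows, so two edges cannot spoil all \<open>n\<close> of them.\<close>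

lemma free_row_pair:
  assumes "odd n" "hcount p n T i + vcount p n T i + vcount p n T (i + 1) < 3"
  obtains r where "0 \<le> r" "r < n" "hedge p i r \<notin> T" "row_free T i r" "row_free T (i + 1) r"
proof (rule ccontr)
  assume "\<not> thesis"
  then have blocked: "{0..<n} \<subseteq> {r \<in> {0..<n}. hedge p i r \<in> T} \<union>
      ({r \<in> {0..<n}. \<not> row_free T i r} \<union> {r \<in> {0..<n}. \<not> row_free T (i + 1) r})"
    using that by fastforce
  let ?K = "nat ((n - 1) div 2)"
  have "nat n = card {0..<n}"
    by simp
  also have "\<dots> \<le> card ({r \<in> {0..<n}. hedge p i r \<in> T} \<union>
      ({r \<in> {0..<n}. \<not> row_free T i r} \<union> {r \<in> {0..<n}. \<not> row_free T (i + 1) r}))"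
    by (intro card_mono blocked finite_UnI finite_range_Collect)
  also have "\<dots> \<le> hcount p n T i + (vcount p n T i * ?K + vcount p n T (i + 1) * ?K)"
    unfolding hcount_def using blocked_rows_card[OF assms(1)]
    by (intro order_trans[OF card_Un_le] add_mono order_refl)
  also have "\<dots> \<le> hcount p n T i * ?K + (vcount p n T i * ?K + vcount p n T (i + 1) * ?K)"
    using n3 by (intro add_mono order_refl) (cases ?K, auto)
  also have "\<dots> = (hcount p n T i + vcount p n T i + vcount p n T (i + 1)) * ?K"
    by (simp add: algebra_simps)
  also have "\<dots> \<le> 2 * ?K"
    using assms(2) by (intro mult_le_mono1) simp
  also have "\<dots> < nat n"
    using n3 by linarith
  finally show False
    by simp
qed

lemma free_row_single:
  assumes "odd n" "vcount p n T i < 3"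
  obtains r where "0 \<le> r" "r < n" "row_free T i r"
proof (rule ccontr)
  assume "\<not> thesis"
  then have all_blocked: "{0..<n} = {r \<in> {0..<n}. \<not> row_free T i r}"
    using that by fastforce
  have "card {0..<n} \<le> vcount p n T i * nat ((n - 1) div 2)"
    by (subst all_blocked) (rule blocked_rows_card[OF assms(1)])
  then have "nat n \<le> vcount p n T i * nat ((n - 1) div 2)"
    by simp
  also have "\<dots> \<le> 2 * nat ((n - 1) div 2)"
    using assms(2) by (intro mult_le_mono1) simp
  also have "\<dots> < nat n"
    using n3 by linarith
  finally show False
    by simp
qed

text \<open>Column \<open>0\<close> leaves out one vertex, and the columns \<open>1, 2\<close>, then \<open>3, 4\<close> and so on are matched in pairs. The rows of
the vertex left out and of the horizontal edges are chosen independently of each other, so one of these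
choices must already be impossible.\<close>

lemma hitting_blocks_pairing_0:
  assumes odd: "odd m" "odd n" and hit: "hitting G T"
  shows "3 \<le> vcount p n T 0 \<or>
    (\<exists>i. odd i \<and> 0 < i \<and> i < m \<and> 3 \<le> hcount p n T i + vcount p n T i + vcount p n T (i + 1))"
proof (rule ccontr)
  assume neg: "\<not> ?thesis"
  then have "\<not> 3 \<le> vcount p n T 0"
    by blast
  then obtain r where r: "0 \<le> r" "r < n" "row_free T 0 r"
    using free_row_single[OF odd(2), of T 0] by (metis not_le)
  have "\<exists>r. odd i \<and> 0 < i \<and> i < m \<longrightarrow>
      0 \<le> r \<and> r < n \<and> hedge p i r \<notin> T \<and> row_free T i r \<and> row_free T (i + 1) r" for i
  proof (cases "odd i \<and> 0 < i \<and> i < m")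
    case True
    then have "\<not> 3 \<le> hcount p n T i + vcount p n T i + vcount p n T (i + 1)"
      using neg by blast
    then show ?thesis
      using free_row_pair[OF odd(2), of T i] by (metis not_le)
  qed blast
  then obtain \<rho> where \<rho>: "\<And>i. odd i \<and> 0 < i \<and> i < m \<longrightarrow>
      0 \<le> \<rho> i \<and> \<rho> i < n \<and> hedge p i (\<rho> i) \<notin> T \<and> row_free T i (\<rho> i) \<and> row_free T (i + 1) (\<rho> i)"
    using choice[of "\<lambda>i r. odd i \<and> 0 < i \<and> i < m \<longrightarrow>
      0 \<le> r \<and> r < n \<and> hedge p i r \<notin> T \<and> row_free T i r \<and> row_free T (i + 1) r"] by blast
  \<comment> \<open>The row in which column \<open>i\<close> is not matched vertically; the two columns of a pair share it.\<close>
  define \<sigma> where "\<sigma> i = (if i = 0 then r else if odd i then \<rho> i else \<rho> (i - 1))" for i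
  have \<sigma>: "0 \<le> \<sigma> i \<and> \<sigma> i < n \<and> row_free T i (\<sigma> i)" if "0 \<le> i" "i < m" for i
  proof -
    have "i = 0 \<or> odd i \<and> 0 < i \<or> odd (i - 1) \<and> 0 < i - 1"
      using that(1) by presburger
    then consider "i = 0" | "odd i" "0 < i" | "odd (i - 1)" "0 < i - 1"
      by blast
    then show ?thesis
      using \<rho>[of i] \<rho>[of "i - 1"] r that by cases (simp_all add: \<sigma>_def)
  qed
  let ?P = "\<lambda>i j. odd i \<and> j = \<sigma> i" and ?Q = "\<lambda>i j. odd ((j - \<sigma> i) mod n)"
  have "maximum_matching G (pattern ?P ?Q)"
  proof (rule matching_pattern(1))
    fix i j assume ij: "0 \<le> i" "i < m" "0 \<le> j" "j < n"
    have col: "of_bool (?Q i j) + of_bool (?Q i ((j - 1) mod n)) = (of_bool (j \<noteq> \<sigma> i) :: nat)"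
      using \<sigma>[OF ij(1,2)] ij by (intro odd_cycle_load[OF odd(2)]) simp_all
    have "of_bool (?P i j) + of_bool (?P ((i - 1) mod m) j) = (of_bool (j = \<sigma> i \<and> i \<noteq> 0) :: nat)"
      using ij odd(1) by (auto simp: pred_mod \<sigma>_def)
    then have "load ?P ?Q i j = of_bool (j = \<sigma> i \<and> i \<noteq> 0) + of_bool (j \<noteq> \<sigma> i)"
      unfolding load_def using col by linarith
    also have "\<dots> = of_bool ((i, j) \<noteq> (0, r))"
      by (cases "i = 0") (simp_all add: \<sigma>_def[of 0])
    finally show "load ?P ?Q i j = of_bool ((i, j) \<noteq> (0, r))" .
  qed
  from hit this show False
  proof (cases rule: hittingE)
    case (1 i j)
    then have "odd i"
      by simp
    moreover have "0 < i"
      using \<open>odd i\<close> \<open>0 \<le> i\<close> by presburger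
    ultimately show ?thesis
      using \<rho>[of i] 1 by (simp add: \<sigma>_def)
  next
    case (2 i j)
    then show ?thesis
      using \<sigma>[of i] by (simp add: row_free_def)
  qed
qed

lemma hitting_blocks_pairing:
  assumes "odd m" "odd n" "hitting G T"
  shows "3 \<le> vcount p n T c \<or>
    (\<exists>i. odd i \<and> 0 < i \<and> i < m \<and> 3 \<le> hcount p n T (i + c) + vcount p n T (i + c) + vcount p n T (i + c + 1))"
  using torus.hitting_blocks_pairing_0[OF torus_shift_col[of c] assms]
  by (simp add: counts_reparametrized add.commute add.left_commute)

text \<open>The vertex \<open>(0, r)\<close> is left out, the rest of column \<open>0\<close> is matched with column \<open>1\<close>, and the remaining vertex \<open>(1, r)\<close> with
\<open>(2, r)\<close>. From column \<open>2\<close> on everything is vertical except for one horizontal edge in each of the pairs \<open>3, 4\<close>, then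
\<open>5, 6\<close> and so on. The vertical edges in the columns \<open>0\<close> and \<open>1\<close> are thus avoided altogether.\<close>

lemma no_hitting_two_columns:
  assumes odd: "odd m" "odd n" and "5 \<le> m" and hit: "hitting G T"
    and vert: "\<And>i. 2 \<le> i \<Longrightarrow> i < m \<Longrightarrow> vcount p n T i = 0"
    and r: "0 \<le> r" "r < n" "hedge p 1 r \<notin> T" "\<And>j. 0 \<le> j \<Longrightarrow> j < n \<Longrightarrow> j \<noteq> r \<Longrightarrow> hedge p 0 j \<notin> T"
    and hor: "\<And>i. odd i \<Longrightarrow> 3 \<le> i \<Longrightarrow> i < m \<Longrightarrow> hcount p n T i < nat n"
  shows False
proof -
  have "\<exists>s. odd i \<and> 3 \<le> i \<and> i < m \<longrightarrow> 0 \<le> s \<and> s < n \<and> hedge p i s \<notin> T" for i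
    using hor[of i] free_row[of T i] by metis
  then obtain \<rho> where \<rho>: "\<And>i. odd i \<and> 3 \<le> i \<and> i < m \<longrightarrow> 0 \<le> \<rho> i \<and> \<rho> i < n \<and> hedge p i (\<rho> i) \<notin> T"
    using choice[of "\<lambda>i s. odd i \<and> 3 \<le> i \<and> i < m \<longrightarrow> 0 \<le> s \<and> s < n \<and> hedge p i s \<notin> T"] by blast
  \<comment> \<open>The row in which column \<open>i\<close> is not matched vertically.\<close>
  define \<sigma> where "\<sigma> i = (if i = 2 then r else if odd i then \<rho> i else \<rho> (i - 1))" for i
  have \<sigma>: "0 \<le> \<sigma> i" "\<sigma> i < n" if "2 \<le> i" "i < m" for i
  proof -
    have "i = 2 \<or> odd i \<and> 3 \<le> i \<or> odd (i - 1) \<and> even i \<and> i \<noteq> 2 \<and> 3 \<le> i - 1"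
      using that(1) by presburger
    then show "0 \<le> \<sigma> i" "\<sigma> i < n"
      using \<rho>[of i] \<rho>[of "i - 1"] r that by (auto simp: \<sigma>_def)
  qed
  define P where "P i j \<longleftrightarrow> i = 0 \<and> j \<noteq> r \<or> i = 1 \<and> j = r \<or> 3 \<le> i \<and> odd i \<and> j = \<sigma> i" for i j
  define Q where "Q i j \<longleftrightarrow> 2 \<le> i \<and> odd ((j - \<sigma> i) mod n)" for i j
  have "maximum_matching G (pattern P Q)"
  proof (rule matching_pattern(1))
    fix i j assume ij: "0 \<le> i" "i < m" "0 \<le> j" "j < n"
    have col: "of_bool (Q i j) + of_bool (Q i ((j - 1) mod n)) = (of_bool (2 \<le> i \<and> j \<noteq> \<sigma> i) :: nat)"
      using odd_cycle_load[OF odd(2) \<sigma> ij(3,4), of i] ij by (cases "2 \<le> i") (simp_all add: Q_def)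
    have "i = 0 \<or> i = 1 \<or> i = 2 \<or> 3 \<le> i \<and> odd i \<or> 3 \<le> i - 1 \<and> even i \<and> odd (i - 1)"
      using ij(1) by presburger
    then have row: "of_bool (P i j) + of_bool (P ((i - 1) mod m) j)
        = (of_bool (if i = 0 then j \<noteq> r else i = 1 \<or> j = \<sigma> i) :: nat)"
      using ij odd(1) \<open>5 \<le> m\<close> by (elim disjE) (simp_all add: pred_mod zmod_minus1 P_def \<sigma>_def)
    have "load P Q i j = of_bool (if i = 0 then j \<noteq> r else i = 1 \<or> j = \<sigma> i) + of_bool (2 \<le> i \<and> j \<noteq> \<sigma> i)"
      unfolding load_def using col row by linarith
    also have "\<dots> = of_bool ((i, j) \<noteq> (0, r))"
      using ij(1) by (cases "i = 0"; cases "i = 1") simp_all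
    finally show "load P Q i j = of_bool ((i, j) \<noteq> (0, r))" .
  qed
  from hit this show False
  proof (cases rule: hittingE)
    case (1 i j)
    then show ?thesis
      using r(3) r(4)[of j] \<rho>[of i] unfolding P_def by (elim disjE conjE) (simp_all add: \<sigma>_def)
  next
    case (2 i j)
    then show ?thesis
      using vert[of i] counts_pos(2)[of i j T] by (simp add: Q_def)
  qed
qed

lemma counts_cong:
  assumes "x mod m = y mod m"
  shows "hcount p n T x = hcount p n T y" "vcount p n T x = vcount p n T y"
  using counts_mod[of T x] counts_mod[of T y] assms by simp_all

lemma hcount_0_free: "hcount p n T i = 0 \<Longrightarrow> hedge p i j \<notin> T"
  using counts_pos(1)[of i j T] by auto

lemma no_hitting_empty_level_open:
  assumes odd: "odd m" "odd n" and "5 \<le> m" and hit: "hitting G T"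
    and vert: "\<And>i. 2 \<le> i \<Longrightarrow> i < m \<Longrightarrow> vcount p n T i = 0"
    and empty: "hcount p n T 0 = 0"
    and hor: "\<And>i. odd i \<Longrightarrow> 1 \<le> i \<Longrightarrow> i < m \<Longrightarrow> hcount p n T i < nat n"
  shows False
proof -
  have "hcount p n T 1 < nat n"
    using hor[of 1] m3 by simp
  then obtain r where "0 \<le> r" "r < n" "hedge p 1 r \<notin> T"
    using free_row[of T 1] by blast
  then show False
    using hcount_0_free[OF empty] hor by (intro no_hitting_two_columns[OF odd \<open>5 \<le> m\<close> hit vert, of r]) simp_all
qed

lemma torus_reflect_col: "torus G m n (\<lambda>i. p (c - i))"
  using torus_reflect[of c] by simp

lemma total_counts_reparametrized:
  "hedges (\<lambda>i. p (i + a)) = hedges p" "vedges (\<lambda>i. p (i + a)) = vedges p"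
  "hedges (\<lambda>i. p (c - i)) = hedges p" "vedges (\<lambda>i. p (c - i)) = vedges p"
  using hedges_vedges_shift[of a 0] hedges_vedges_reflect[of c] by simp_all

lemma hcount_subset_le:
  assumes "X \<subseteq> {0..<m}" "card (T \<inter> hedges p) = k"
  shows "(\<Sum>i\<in>X. hcount p n T i) \<le> k"
  using sum_mono2[OF _ assms(1), of "hcount p n T"] sum_counts(1)[of T] assms(2) by simp

lemma vcount_subset_le:
  assumes "X \<subseteq> {0..<m}" "card (T \<inter> vedges p) = k"
  shows "(\<Sum>i\<in>X. vcount p n T i) \<le> k"
  using sum_mono2[OF _ assms(1), of "vcount p n T"] sum_counts(2)[of T] assms(2) by simp

text \<open>The only obstruction is a level with odd index that lies entirely in \<open>T\<close>. All horizontal edges of \<open>T\<close> are then on this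
level, and the reflection that exchanges the columns \<open>0\<close> and \<open>1\<close> gives it an even index.\<close>

lemma no_hitting_empty_level:
  assumes odd: "odd m" "odd n" and "5 \<le> m" and hit: "hitting G T"
    and vert: "\<And>i. 2 \<le> i \<Longrightarrow> i < m \<Longrightarrow> vcount p n T i = 0"
    and empty: "hcount p n T 0 = 0" and three: "card (T \<inter> hedges p) = 3"
  shows False
proof (cases "\<exists>k. odd k \<and> 1 \<le> k \<and> k < m \<and> nat n \<le> hcount p n T k")
  case False
  then have "hcount p n T i < nat n" if "odd i" "1 \<le> i" "i < m" for i
    using that not_le by blast
  then show False
    using no_hitting_empty_level_open[OF odd \<open>5 \<le> m\<close> hit vert empty] by blast
next
  case True
  then obtain k where k: "odd k" "1 \<le> k" "k < m" "nat n \<le> hcount p n T k"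
    by blast
  have other: "hcount p n T i = 0" if "0 \<le> i" "i < m" "i \<noteq> k" for i
    using hcount_subset_le[of "{i, k}" T 3] k that three n3 by simp
  have mod: "hcount p n T (- i) = hcount p n T (m - i)" "vcount p n T (1 - i) = vcount p n T (m + 1 - i)" for i
    by (rule counts_cong; simp add: mod_eq_dvd_iff)+
  interpret reflected: torus G m n "\<lambda>i. p (1 - i)"
    by (rule torus_reflect_col)
  show False
  proof (rule reflected.no_hitting_empty_level_open[OF odd \<open>5 \<le> m\<close> hit], unfold counts_reparametrized)
    show "vcount p n T (1 - i) = 0" if "2 \<le> i" "i < m" for i
      using vert[of "m + 1 - i"] that mod(2) by simp
    show "hcount p n T (1 - 0 - 1) = 0"
      using empty by simp
    show "hcount p n T (1 - i - 1) < nat n" if "odd i" "1 \<le> i" "i < m" for i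
    proof -
      have "m - i \<noteq> k"
        using k(1) odd(1) that(1) by presburger
      then show ?thesis
        using other[of "m - i"] that mod(1)[of i] n3 by simp
    qed
  qed
qed

lemma no_hitting_single_edge_level:
  assumes odd: "odd m" "odd n" and "5 \<le> m" and hit: "hitting G T"
    and vert: "\<And>i. 2 \<le> i \<Longrightarrow> i < m \<Longrightarrow> vcount p n T i = 0"
    and single: "hcount p n T 0 = 1" and empty: "hcount p n T 1 = 0"
    and hor: "\<And>i. odd i \<Longrightarrow> 3 \<le> i \<Longrightarrow> i < m \<Longrightarrow> hcount p n T i < nat n"
  shows False
proof -
  obtain r where r: "{j \<in> {0..<n}. hedge p 0 j \<in> T} = {r}"
    using single unfolding hcount_def by (rule card_1_singletonE)
  then have "r \<in> {0..<n}" "\<And>j. j \<in> {0..<n} \<Longrightarrow> j \<noteq> r \<Longrightarrow> hedge p 0 j \<notin> T"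
    by blast+
  then show False
    using hcount_0_free[OF empty] hor by (intro no_hitting_two_columns[OF odd \<open>5 \<le> m\<close> hit vert, of r]) simp_all
qed

text \<open>If the level to the right or to the left of column \<open>0\<close> contains no edge of \<open>T\<close>, \<open>no_hitting_empty_level\<close> applies,
up to a reflection. Otherwise at most one horizontal edge of \<open>T\<close> is elsewhere. Hence one of the two
levels contains a single edge of \<open>T\<close> and the level beyond it contains none. The vertex of column \<open>0\<close> on that
single edge can then be left out.\<close>

lemma no_hitting_single_column:
  assumes odd: "odd m" "odd n" and "5 \<le> m" and hit: "hitting G T"
    and vert: "\<And>i. 1 \<le> i \<Longrightarrow> i < m \<Longrightarrow> vcount p n T i = 0"
    and three: "card (T \<inter> hedges p) = 3"
  shows False
proof -
  interpret reflected: torus G m n "\<lambda>i. p (0 - i)"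
    by (rule torus_reflect_col)
  have mod: "hcount p n T (- i) = hcount p n T (m - i)" "vcount p n T (- i) = vcount p n T (m - i)"
    "hcount p n T (- i - 1) = hcount p n T (m - 1 - i)" for i
    by (rule counts_cong; simp add: mod_eq_dvd_iff)+
  have rvert: "vcount p n T (0 - i) = 0" if "2 \<le> i" "i < m" for i
    using vert[of "m - i"] that mod(2)[of i] by simp
  consider "hcount p n T 0 = 0" | "hcount p n T (m - 1) = 0"
    | "hcount p n T 0 \<ge> 1" "hcount p n T (m - 1) \<ge> 1"
    by linarith
  then show False
  proof cases
    case 1
    then show False
      using vert three by (intro no_hitting_empty_level[OF odd \<open>5 \<le> m\<close> hit]) simp_all
  next
    case 2
    show False
    proof (rule reflected.no_hitting_empty_level[OF odd \<open>5 \<le> m\<close> hit], unfold counts_reparametrized total_counts_reparametrized)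
      show "hcount p n T (0 - 0 - 1) = 0"
        using 2 mod(3)[of 0] by simp
    qed (use rvert three in blast)+
  next
    case 3
    have other: "hcount p n T x < nat n" if "0 < x" "x < m - 1" for x
    proof -
      have "hcount p n T 0 + (hcount p n T (m - 1) + hcount p n T x) \<le> 3"
        using hcount_subset_le[of "{0, m - 1, x}" T 3] that three m3 by simp
      then show ?thesis
        using 3 n3 by linarith
    qed
    have four: "hcount p n T 0 + (hcount p n T 1 + (hcount p n T (m - 2) + hcount p n T (m - 1))) \<le> 3"
      using hcount_subset_le[of "{0, 1, m - 2, m - 1}" T 3] three \<open>5 \<le> m\<close> by simp
    then consider "hcount p n T 0 = 1" "hcount p n T 1 = 0" | "hcount p n T (m - 1) = 1" "hcount p n T (m - 2) = 0"
      using 3 by linarith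
    then show False
    proof cases
      case 1
      have "i < m - 1" if "odd i" "i < m" for i
        using that odd(1) by presburger
      then show False
        using vert 1 other by (intro no_hitting_single_edge_level[OF odd \<open>5 \<le> m\<close> hit]) simp_all
    next
      case 2
      show False
      proof (rule reflected.no_hitting_single_edge_level[OF odd \<open>5 \<le> m\<close> hit], unfold counts_reparametrized)
        show "hcount p n T (0 - 0 - 1) = 1" "hcount p n T (0 - 1 - 1) = 0"
          using 2 mod(3)[of 0] mod(3)[of 1] by simp_all
        show "hcount p n T (0 - i - 1) < nat n" if "odd i" "3 \<le> i" "i < m" for i
        proof -
          have "i < m - 1"
            using that odd(1) by presburger
          then show ?thesis
            using other[of "m - 1 - i"] that mod(3)[of i] by simp
        qed
      qed (use rvert in blast)
    qed
  qed
qed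

lemma card_le_2_subset:
  assumes "finite B" "card B \<le> 2"
  obtains a b where "B \<subseteq> {a, b}"
proof (cases "B = {}")
  case False
  then obtain a where "a \<in> B"
    by blast
  then have "card (B - {a}) \<le> Suc 0"
    using assms by (simp add: card_Diff_singleton)
  then have "\<forall>x\<in>B - {a}. \<forall>y\<in>B - {a}. x = y"
    using assms(1) by (simp add: card_le_Suc0_iff_eq)
  then show ?thesis
    using that[of a a] that by (cases "B \<subseteq> {a}") blast+
qed (use that in blast)

text \<open>These are the edges of \<open>T\<close> that can interfere with matching the columns \<open>i\<close> and \<open>i + 1\<close> with each other.\<close>

definition cost :: "'a set set \<Rightarrow> int \<Rightarrow> nat" where
  "cost T i = hcount p n T i + vcount p n T i + vcount p n T (i + 1)"

lemma cost_mod: "cost T (i mod m) = cost T i"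
proof -
  have "vcount p n T (i mod m + 1) = vcount p n T (i + 1)"
    by (rule counts_cong) (simp add: mod_add_left_eq)
  then show ?thesis
    by (simp add: cost_def counts_mod)
qed

text \<open>The pairing that leaves out column \<open>c\<close> uses level \<open>i\<close> exactly if \<open>(i - c) mod m\<close> is odd. If only the levels \<open>a\<close> and
\<open>b\<close> were costly, then \<open>c = a\<close> or \<open>c = b\<close> would avoid both, as the residues of \<open>a - b\<close> and \<open>b - a\<close> add up to the odd number \<open>m\<close> unless \<open>a = b\<close>.\<close>

lemma three_costly_levels:
  assumes odd: "odd m" "odd n" and hit: "hitting G T" and few: "\<And>i. vcount p n T i < 3"
  shows "3 \<le> card {i \<in> {0..<m}. 3 \<le> cost T i}" (is "3 \<le> card ?B")
proof (rule ccontr)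
  assume "\<not> 3 \<le> card ?B"
  moreover have "finite ?B"
    by (rule finite_subset[of _ "{0..<m}"]) auto
  ultimately obtain a b where B: "?B \<subseteq> {a, b}"
    using card_le_2_subset[of ?B] by force
  have "odd ((b - a) mod m) \<Longrightarrow> even ((a - b) mod m)"
    using zmod_zminus1_eq_if[of "b - a" m] odd(1) by (auto split: if_splits)
  then obtain c where c: "even ((a - c) mod m)" "even ((b - c) mod m)"
    by (cases "even ((b - a) mod m)") (use that[of a] that[of b] in simp_all)
  obtain k where k: "odd k" "0 < k" "k < m" "3 \<le> cost T (k + c)"
    using hitting_blocks_pairing[OF odd hit, of c] few[of c] unfolding cost_def by (meson not_le)
  then have "(k + c) mod m \<in> ?B"
    using mod_box by (simp add: cost_mod)
  then have "(k + c) mod m = a \<or> (k + c) mod m = b"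
    using B by blast
  moreover have "((k + c) mod m - c) mod m = k"
    using k(2,3) by (simp add: mod_diff_left_eq)
  ultimately show False
    using c k(1) by auto
qed

lemma sum_cost:
  assumes B: "B \<subseteq> {0..<m}"
  shows "(\<Sum>i\<in>B. cost T i) = (\<Sum>i\<in>B. hcount p n T i) + (\<Sum>i\<in>B. vcount p n T i)
      + (\<Sum>i\<in>(\<lambda>i. (i + 1) mod m) ` B. vcount p n T i)"
    and "(\<lambda>i. (i + 1) mod m) ` B \<subseteq> {0..<m}"
proof -
  have "inj_on (\<lambda>i. (i + 1) mod m) B"
  proof (rule inj_onI)
    fix x y assume "x \<in> B" "y \<in> B" "(x + 1) mod m = (y + 1) mod m"
    then have "x mod m = y mod m"
      by (simp add: mod_eq_dvd_iff)
    moreover have "x \<in> {0..<m}" "y \<in> {0..<m}"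
      using B \<open>x \<in> B\<close> \<open>y \<in> B\<close> by blast+
    ultimately show "x = y"
      by simp
  qed
  then have "(\<Sum>i\<in>(\<lambda>i. (i + 1) mod m) ` B. vcount p n T i) = (\<Sum>i\<in>B. vcount p n T (i + 1))"
    by (simp add: sum.reindex counts_mod)
  then show "(\<Sum>i\<in>B. cost T i) = (\<Sum>i\<in>B. hcount p n T i) + (\<Sum>i\<in>B. vcount p n T i)
      + (\<Sum>i\<in>(\<lambda>i. (i + 1) mod m) ` B. vcount p n T i)"
    by (simp add: cost_def sum.distrib)
  show "(\<lambda>i. (i + 1) mod m) ` B \<subseteq> {0..<m}"
    using mod_box by auto
qed

text \<open>Three costly levels amount to \<open>9\<close>, but summing over all levels counts a horizontal edge once and a vertical edge twice. With
\<open>h + v \<le> 6\<close> this yields \<open>9 \<le> h + 2v \<le> 6 + v\<close>.\<close>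

lemma vertical_edges_ge_3:
  assumes odd: "odd m" "odd n" and hit: "hitting G T"
    and six: "card (T \<inter> hedges p) + card (T \<inter> vedges p) \<le> 6"
  shows "3 \<le> card (T \<inter> vedges p)"
proof (cases "\<exists>i. 3 \<le> vcount p n T i")
  case True
  then obtain i where "3 \<le> vcount p n T (i mod m)"
    by (auto simp: counts_mod)
  then show ?thesis
    using vcount_subset_le[of "{i mod m}" T "card (T \<inter> vedges p)"] mod_box by simp
next
  case False
  let ?B = "{i \<in> {0..<m}. 3 \<le> cost T i}"
  have B: "?B \<subseteq> {0..<m}"
    by blast
  have "vcount p n T i < 3" for i
    using False not_le by blast
  then have "3 * 3 \<le> 3 * card ?B"
    using three_costly_levels[OF odd hit] by simp
  also have "\<dots> \<le> (\<Sum>i\<in>?B. cost T i)"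
    using sum_bounded_below[of ?B 3 "cost T"] by simp
  also have "\<dots> \<le> card (T \<inter> hedges p) + card (T \<inter> vedges p) + card (T \<inter> vedges p)"
    unfolding sum_cost(1)[OF B]
    by (intro add_mono hcount_subset_le vcount_subset_le sum_cost(2) B refl)
  finally show ?thesis
    using six by linarith
qed

text \<open>With three edges in each direction the estimate \<open>9 \<le> h + 2v\<close> is an equality, so the costly levels account for each horizontal edge
and for each vertical edge on both of its sides.\<close>

lemma costly_levels_tight:
  assumes odd: "odd m" "odd n" and hit: "hitting G T" and few: "\<And>i. vcount p n T i < 3"
    and h: "card (T \<inter> hedges p) = 3" and v: "card (T \<inter> vedges p) = 3"
  obtains B where "B \<subseteq> {0..<m}" "card B = 3" "\<And>i. i \<in> B \<Longrightarrow> cost T i = 3"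
    "\<And>i. 0 < hcount p n T i \<Longrightarrow> i mod m \<in> B"
    "\<And>i. 0 < vcount p n T i \<Longrightarrow> i mod m \<in> B" "\<And>i. 0 < vcount p n T i \<Longrightarrow> (i - 1) mod m \<in> B"
proof -
  let ?B = "{i \<in> {0..<m}. 3 \<le> cost T i}" and ?s = "\<lambda>i. (i + 1) mod m"
  have B: "?B \<subseteq> {0..<m}"
    by blast
  have finB: "finite ?B"
    using B by (rule finite_subset) simp
  have "3 \<le> card ?B"
    by (rule three_costly_levels[OF odd hit few])
  moreover have below: "3 * card ?B \<le> (\<Sum>i\<in>?B. cost T i)"
    using sum_bounded_below[of ?B 3 "cost T"] by simp
  moreover have sums: "(\<Sum>i\<in>?B. hcount p n T i) \<le> 3" "(\<Sum>i\<in>?B. vcount p n T i) \<le> 3"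
    "(\<Sum>i\<in>?s ` ?B. vcount p n T i) \<le> 3"
    by (rule hcount_subset_le[OF B h] vcount_subset_le[OF B v] vcount_subset_le[OF sum_cost(2)[OF B] v])+
  moreover note sum_cost(1)[OF B, of T]
  ultimately have tight: "card ?B = 3" "(\<Sum>i\<in>?B. cost T i) = 9" "(\<Sum>i\<in>?B. hcount p n T i) = 3"
    "(\<Sum>i\<in>?B. vcount p n T i) = 3" "(\<Sum>i\<in>?s ` ?B. vcount p n T i) = 3"
    by linarith+
  have outside: "i \<in> X" if "X \<subseteq> {0..<m}" "(\<Sum>i\<in>X. f i) = 3" "(\<Sum>i\<in>{0..<m}. f i) = 3" "0 < f i" "i \<in> {0..<m}"
    for f :: "int \<Rightarrow> nat" and X i
  proof (rule ccontr)
    assume "i \<notin> X"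
    have "finite X"
      using that(1) by (rule finite_subset) simp
    then have "(\<Sum>i\<in>insert i X. f i) = f i + 3"
      using \<open>i \<notin> X\<close> that(2) by simp
    moreover have "(\<Sum>i\<in>insert i X. f i) \<le> (\<Sum>i\<in>{0..<m}. f i)"
      using that by (intro sum_mono2) auto
    ultimately show False
      using that(3,4) by simp
  qed
  show thesis
  proof (rule that[OF B tight(1)])
    show "cost T i = 3" if "i \<in> ?B" for i
    proof -
      have "card (?B - {i}) = 2"
        using tight(1) that finB by simp
      moreover have "card (?B - {i}) * 3 \<le> (\<Sum>x\<in>?B - {i}. cost T x)"
        using sum_bounded_below[of "?B - {i}" 3 "cost T"] by simp
      moreover have "(\<Sum>x\<in>?B. cost T x) = cost T i + (\<Sum>x\<in>?B - {i}. cost T x)"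
        using finB that by (rule sum.remove)
      ultimately have "cost T i \<le> 3"
        using tight(2) by linarith
      then show ?thesis
        using that by simp
    qed
    fix i
    show "i mod m \<in> ?B" if "0 < hcount p n T i"
      using tight(3) sum_counts(1)[of T] h that mod_box by (intro outside[OF B, of "hcount p n T"]) (simp_all add: counts_mod)
    show "i mod m \<in> ?B" if "0 < vcount p n T i"
      using tight(4) sum_counts(2)[of T] v that mod_box by (intro outside[OF B, of "vcount p n T"]) (simp_all add: counts_mod)
    show "(i - 1) mod m \<in> ?B" if "0 < vcount p n T i"
    proof -
      have "i mod m \<in> ?s ` ?B"
        using tight(5) sum_counts(2)[of T] v that mod_box
        by (intro outside[OF sum_cost(2)[OF B], of "vcount p n T"]) (simp_all add: counts_mod)
      then obtain x where x: "x \<in> ?B" "i mod m = (x + 1) mod m"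
        by blast
      have "(i - 1) mod m = (x + 1 - 1) mod m"
        using x(2) by (rule mod_diff_cong) simp
      then show ?thesis
        using x(1) by simp
    qed
  qed
qed

text \<open>The costly levels must be those numbered \<open>-1\<close>, \<open>0\<close> and \<open>1\<close>. All vertical edges are then in the columns
\<open>0\<close> and \<open>1\<close>, which exhausts the cost of level \<open>0\<close> and leaves it without horizontal edges.\<close>

lemma no_hitting_adjacent_columns:
  assumes odd: "odd m" "odd n" and "5 \<le> m" and hit: "hitting G T" and few: "\<And>i. vcount p n T i < 3"
    and h: "card (T \<inter> hedges p) = 3" and v: "card (T \<inter> vedges p) = 3"
    and pos: "0 < vcount p n T 0" "0 < vcount p n T 1"
  shows False
proof -
  obtain B where B: "B \<subseteq> {0..<m}" "card B = 3" "\<And>i. i \<in> B \<Longrightarrow> cost T i = 3"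
    and Bh: "\<And>i. 0 < hcount p n T i \<Longrightarrow> i mod m \<in> B"
    and Bv: "\<And>i. 0 < vcount p n T i \<Longrightarrow> i mod m \<in> B" "\<And>i. 0 < vcount p n T i \<Longrightarrow> (i - 1) mod m \<in> B"
    by (rule costly_levels_tight[OF odd hit few h v]) (rule that; assumption)
  have "{m - 1, 0, 1} \<subseteq> B"
    using Bv(1)[OF pos(1)] Bv(1)[OF pos(2)] Bv(2)[OF pos(1)] m3 by (simp add: zmod_minus1)
  moreover have "card {m - 1, 0, 1} = 3"
    using m3 by simp
  moreover have "finite B"
    using B(1) by (rule finite_subset) simp
  ultimately have B_eq: "B = {m - 1, 0, 1}"
    using B(2) by (intro card_seteq[symmetric]) simp_all
  have vert: "vcount p n T i = 0" if "2 \<le> i" "i < m" for i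
  proof (rule ccontr)
    assume "vcount p n T i \<noteq> 0"
    then have "i mod m \<in> B" "(i - 1) mod m \<in> B"
      using Bv[of i] by simp_all
    moreover have "i mod m = i" "(i - 1) mod m = i - 1"
      using that pred_mod[of i m] by simp_all
    ultimately show False
      using that \<open>5 \<le> m\<close> by (auto simp: B_eq)
  qed
  have hor: "hcount p n T i = 0" if "2 \<le> i" "i < m - 1" for i
  proof (rule ccontr)
    assume "hcount p n T i \<noteq> 0"
    then have "i mod m \<in> B"
      using Bh[of i] by simp
    then show False
      using that by (simp add: B_eq)
  qed
  have cost: "cost T 0 = 3" "cost T 1 = 3"
    using B(3) by (simp_all add: B_eq)
  have "(\<Sum>i\<in>{0..<m}. vcount p n T i) = (\<Sum>i\<in>{0, 1}. vcount p n T i)"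
    using vert m3 by (intro sum.mono_neutral_right) auto
  then have "vcount p n T 0 + vcount p n T 1 = 3"
    using v sum_counts(2)[of T] by simp
  then have h0: "hcount p n T 0 = 0"
    using cost(1) by (simp add: cost_def)
  have "hcount p n T 1 \<le> 2"
    using cost(2) pos(2) by (simp add: cost_def)
  then have "hcount p n T 1 < nat n"
    using n3 by linarith
  show False
  proof (rule no_hitting_empty_level_open[OF odd \<open>5 \<le> m\<close> hit vert h0])
    fix i :: int assume i: "odd i" "1 \<le> i" "i < m"
    have "i = 1 \<or> 2 \<le> i \<and> i < m - 1"
      using i odd(1) by presburger
    then show "hcount p n T i < nat n"
      using hor[of i] \<open>hcount p n T 1 < nat n\<close> n3 by auto
  qed
qed

text \<open>Two columns \<open>k\<close> and \<open>l\<close> with vertical edges make the levels \<open>k - 1\<close>, \<open>k\<close>, \<open>l - 1\<close> and \<open>l\<close> costly. There are only three costly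
levels, so the columns are adjacent.\<close>

lemma no_hitting_spread_columns:
  assumes odd: "odd m" "odd n" and "5 \<le> m" and hit: "hitting G T" and few: "\<And>i. vcount p n T i < 3"
    and h: "card (T \<inter> hedges p) = 3" and v: "card (T \<inter> vedges p) = 3"
  shows False
proof -
  obtain B where B: "B \<subseteq> {0..<m}" "card B = 3"
    and Bv: "\<And>i. 0 < vcount p n T i \<Longrightarrow> i mod m \<in> B" "\<And>i. 0 < vcount p n T i \<Longrightarrow> (i - 1) mod m \<in> B"
    by (rule costly_levels_tight[OF odd hit few h v]) (rule that; assumption)
  have total: "(\<Sum>i\<in>{0..<m}. vcount p n T i) = 3"
    using v sum_counts(2)[of T] by simp
  have "\<exists>k\<in>{0..<m}. 0 < vcount p n T k"
  proof (rule ccontr)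
    assume "\<not> ?thesis"
    then have "(\<Sum>i\<in>{0..<m}. vcount p n T i) = 0"
      by simp
    then show False
      using total by simp
  qed
  then obtain k where k: "k \<in> {0..<m}" "0 < vcount p n T k"
    by blast
  have "\<exists>l\<in>{0..<m} - {k}. 0 < vcount p n T l"
  proof (rule ccontr)
    assume "\<not> ?thesis"
    then have "(\<Sum>i\<in>{0..<m} - {k}. vcount p n T i) = 0"
      by simp
    then have "vcount p n T k = 3"
      using total k(1) sum.remove[of "{0..<m}" k "vcount p n T"] by simp
    then show False
      using few[of k] by simp
  qed
  then obtain l where l: "l \<in> {0..<m}" "l \<noteq> k" "0 < vcount p n T l"
    by blast
  have "l = (k - 1) mod m \<or> k = (l - 1) mod m"
  proof (rule ccontr)
    assume neg: "\<not> ?thesis"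
    have "(k - 1) mod m \<noteq> k" "(l - 1) mod m \<noteq> l"
      using k(1) l(1) m3 by (simp_all add: pred_mod)
    moreover have "(k - 1) mod m \<noteq> (l - 1) mod m"
    proof
      assume "(k - 1) mod m = (l - 1) mod m"
      then have "k mod m = l mod m"
        by (simp add: mod_eq_dvd_iff)
      then show False
        using k(1) l(1,2) by simp
    qed
    ultimately have "card {k, l, (k - 1) mod m, (l - 1) mod m} = 4"
      using neg l(2) by simp
    moreover have "{k, l, (k - 1) mod m, (l - 1) mod m} \<subseteq> B"
      using Bv[OF k(2)] Bv[OF l(3)] k(1) l(1) by simp
    moreover have "finite B"
      using B(1) by (rule finite_subset) simp
    ultimately show False
      using card_mono[of B "{k, l, (k - 1) mod m, (l - 1) mod m}"] B(2) by simp
  qed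
  then obtain x where x: "0 < vcount p n T x" "0 < vcount p n T (x + 1)"
  proof
    assume "l = (k - 1) mod m"
    then show thesis
      using that[of "k - 1"] k(2) l(3) by (simp add: counts_mod)
  next
    assume "k = (l - 1) mod m"
    then show thesis
      using that[of "l - 1"] k(2) l(3) by (simp add: counts_mod)
  qed
  interpret shifted: torus G m n "\<lambda>i. p (i + x)"
    by (rule torus_shift_col)
  show False
    by (rule shifted.no_hitting_adjacent_columns[OF odd \<open>5 \<le> m\<close> hit],
        unfold counts_reparametrized total_counts_reparametrized)
      (use few h v x in \<open>simp_all add: add.commute\<close>)
qed

lemma hitting_card_ge_7:
  assumes odd: "odd m" "odd n" and "5 \<le> m" and hit: "hitting G T" and sub: "T \<subseteq> edges G"
  shows "7 \<le> card T"
proof (rule ccontr)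
  assume "\<not> 7 \<le> card T"
  interpret transposed: torus G n m "\<lambda>i j. p j i"
    by (rule torus_transpose)
  have transposed: "hedges (\<lambda>i j. p j i) = vedges p" "vedges (\<lambda>i j. p j i) = hedges p"
    unfolding transpose_edges by blast+
  have "finite T"
    using sub finite_edges[OF G] by (rule finite_subset)
  have "T = (T \<inter> hedges p) \<union> (T \<inter> vedges p)"
    using sub unfolding edges by blast
  then have "card T = card ((T \<inter> hedges p) \<union> (T \<inter> vedges p))"
    by (rule arg_cong)
  also have "\<dots> = card (T \<inter> hedges p) + card (T \<inter> vedges p)"
    using \<open>finite T\<close> by (intro card_Un_disjoint) (auto simp: hedge_neq_vedge)
  finally have "card T = card (T \<inter> hedges p) + card (T \<inter> vedges p)" .
  then have six: "card (T \<inter> hedges p) + card (T \<inter> vedges p) \<le> 6"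
    using \<open>\<not> 7 \<le> card T\<close> by simp
  have "3 \<le> card (T \<inter> vedges p)"
    by (rule vertical_edges_ge_3[OF odd hit six])
  moreover have "3 \<le> card (T \<inter> hedges p)"
    using transposed.vertical_edges_ge_3[OF odd(2,1) hit] six unfolding transposed by simp
  ultimately have h: "card (T \<inter> hedges p) = 3" and v: "card (T \<inter> vedges p) = 3"
    using six by linarith+
  show False
  proof (cases "\<exists>c. 3 \<le> vcount p n T c")
    case False
    then have "vcount p n T i < 3" for i
      using not_le by blast
    then show False
      using no_hitting_spread_columns[OF odd \<open>5 \<le> m\<close> hit _ h v] by blast
  next
    case True
    then obtain c where c: "3 \<le> vcount p n T c"
      by blast
    interpret shifted: torus G m n "\<lambda>i. p (i + c)"
      by (rule torus_shift_col)
    show False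
    proof (rule shifted.no_hitting_single_column[OF odd \<open>5 \<le> m\<close> hit],
        unfold counts_reparametrized total_counts_reparametrized)
      fix i :: int assume i: "1 \<le> i" "i < m"
      have "(\<Sum>x\<in>{0, i}. vcount (\<lambda>i. p (i + c)) n T x) \<le> 3"
        using i v by (intro shifted.vcount_subset_le) (simp, simp only: total_counts_reparametrized)
      then show "vcount p n T (i + c) = 0"
        using c i by (simp add: counts_reparametrized)
    qed (rule h)
  qed
qed

lemma tau_odd_lower:
  assumes "odd m" "odd n" "transversal_set d G T" "d \<ge> 1"
  shows "4 * d + 2 \<le> tau d G"
  using odd_transversal_card[OF assms(1,2) _ assms(4)] by (rule tau_ge[OF G assms(3)])

lemma nat_area_odd:
  assumes "odd m" "odd n"
  shows "nat (m * n) mod 2 = 1"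
proof -
  have "odd (m * n)" "0 \<le> m * n"
    using assms m3 n3 by simp_all
  then have "odd (nat (m * n))"
    by (simp add: even_nat_iff)
  then show ?thesis
    by presburger
qed

lemma tau_odd_large:
  assumes odd: "odd m" "odd n" and "n \<le> m"
    and d: "1 \<le> d" "d \<le> nat (m * n) div 2" "nat (m * n) div 2 \<le> d + nat m * nat (n div 2)"
  shows "tau d G = 4 * d + 2"
proof -
  have "even m \<or> odd m \<and> odd n \<and> n \<le> m"
    using odd \<open>n \<le> m\<close> by simp
  moreover have "nat (m * n) div 2 - d \<le> nat m * nat (n div 2)"
    using d(3) by linarith
  ultimately obtain N where N: "independent G N" "card N = nat (m * n) div 2 - d"
    by (rule ex_independent)
  have "even m \<or> odd m \<and> odd n" "d + card N = nat (m * n) div 2"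
    using odd N(2) d(2) by simp_all
  then obtain T where T: "transversal_set d G T" "card T = 4 * d + 2 * (nat (m * n) mod 2)"
    by (rule off_stars_bound[OF _ N(1)])
  show ?thesis
    using tau_le[OF G T(1)] T(2) tau_odd_lower[OF odd T(1) d(1)] nat_area_odd[OF odd] by simp
qed

lemma tau_odd_small:
  assumes odd: "odd m" "odd n" and "n \<le> m" and d: "1 \<le> d" "d + 1 \<le> nat m * nat (n div 2)"
  shows "4 * d + 2 \<le> tau d G" "tau d G \<le> 4 * d + 4"
proof -
  have "even m \<or> odd m \<and> odd n \<and> n \<le> m"
    using odd \<open>n \<le> m\<close> by simp
  then obtain N where N: "independent G N" "card N = d + 1"
    using d(2) by (rule ex_independent)
  have "even m \<or> odd m \<and> odd n" "card N = d + nat (m * n) mod 2"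
    using odd N(2) nat_area_odd[OF odd] by simp_all
  then obtain T where T: "transversal_set d G T" "card T = 4 * card N"
    by (rule stars_bound[OF _ N(1)])
  show "4 * d + 2 \<le> tau d G"
    using tau_odd_lower[OF odd T(1) d(1)] .
  show "tau d G \<le> 4 * d + 4"
    using tau_le[OF G T(1)] T(2) N(2) by simp
qed

lemma tau_odd_1:
  assumes odd: "odd m" "odd n" and "5 \<le> m"
  shows "tau 1 G = 7"
proof -
  obtain T where T: "transversal_set 1 G T" "card T \<le> 7"
    by (rule adjacent_stars_bound[OF odd])
  have "7 \<le> card T" if "transversal_set 1 G T" for T
  proof (rule hitting_card_ge_7[OF odd \<open>5 \<le> m\<close>])
    show "hitting G T"
      using that by (force simp: transversal_set_def hitting_def)
    show "T \<subseteq> edges G"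
      using that by (simp add: transversal_set_def)
  qed
  then have "7 \<le> tau 1 G"
    by (rule tau_ge[OF G T(1)])
  then show ?thesis
    using tau_le[OF G T(1)] T(2) by simp
qed

end

section \<open>The torus grid as a Cartesian product\<close>

lemma product_edge_left:
  assumes "{g1, g2} \<in> edges G" "g1 \<in> verts G" "g2 \<in> verts G" "h \<in> verts H"
  shows "{(g1, h), (g2, h)} \<in> edges (G \<box> H)"
  unfolding cartesian_product_def snd_conv using assms by blast

lemma product_edge_right:
  assumes "{h1, h2} \<in> edges H" "h1 \<in> verts H" "h2 \<in> verts H" "g \<in> verts G"
  shows "{(g, h1), (g, h2)} \<in> edges (G \<box> H)"
  unfolding cartesian_product_def snd_conv using assms by blast

text \<open>The coordinates are reduced modulo the two cycle lengths; the first factor runs horizontally.\<close>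

lemma torus_cycle_product:
  assumes "3 \<le> m" "3 \<le> n"
  shows "torus (cycle_graph m \<box> cycle_graph n) (int m) (int n) (\<lambda>i j. (nat (i mod int m), nat (j mod int n)))"
    (is "torus ?G _ _ ?p")
proof
  show "simple_graph ?G"
    using assms by (intro simple_graph_cartesian_product simple_graph_cycle_graph)
  show "3 \<le> int m" "3 \<le> int n"
    using assms by simp_all
  have pos: "0 < int m" "0 < int n"
    using assms by simp_all
  show "?p i j = ?p i' j' \<longleftrightarrow> i mod int m = i' mod int m \<and> j mod int n = j' mod int n" for i j i' j'
    using pos by (simp add: eq_nat_nat_iff)
  have of_int: "nat (int x mod int k) = x" if "x < k" for x k
    using that by simp
  have lt: "nat (i mod int m) < m" "nat (j mod int n) < n" for i j
    using pos by (simp_all add: nat_less_iff)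
  show "verts ?G = {?p i j | i j. True}"
  proof (intro equalityI subsetI)
    fix v assume "v \<in> verts ?G"
    then obtain a b where "v = (a, b)" "a < m" "b < n"
      by (auto simp: cartesian_product_def cycle_graph_def)
    then have "v = ?p (int a) (int b)"
      using of_int by simp
    then show "v \<in> {?p i j | i j. True}"
      by blast
  next
    fix v assume "v \<in> {?p i j | i j. True}"
    then show "v \<in> verts ?G"
      using lt by (auto simp: cartesian_product_def cycle_graph_def)
  qed
  have suc: "nat ((i + 1) mod int k) = (nat (i mod int k) + 1) mod k" if "0 < k" for i k
  proof -
    have "int ((nat (i mod int k) + 1) mod k) = (i mod int k + 1) mod int k"
      using that by (simp add: zmod_int add.commute)
    also have "\<dots> = (i + 1) mod int k"
      by (simp add: mod_add_left_eq)
    finally show ?thesis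
      by (metis nat_int)
  qed
  show "edges ?G = hedges ?p \<union> vedges ?p"
  proof (intro equalityI subsetI)
    fix e assume "e \<in> edges ?G"
    then obtain g1 h1 g2 h2 where e: "e = {(g1, h1), (g2, h2)}"
      and "g1 \<in> verts (cycle_graph m)" "g2 \<in> verts (cycle_graph m)"
        "h1 \<in> verts (cycle_graph n)" "h2 \<in> verts (cycle_graph n)"
      and adj: "g1 = g2 \<and> {h1, h2} \<in> edges (cycle_graph n) \<or> {g1, g2} \<in> edges (cycle_graph m) \<and> h1 = h2"
      unfolding cartesian_product_def snd_conv by blast
    then have V: "g1 < m" "g2 < m" "h1 < n" "h2 < n"
      by (simp_all add: cycle_graph_def)
    from adj show "e \<in> hedges ?p \<union> vedges ?p"
    proof (elim disjE conjE)
      assume "g1 = g2" "{h1, h2} \<in> edges (cycle_graph n)"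
      then obtain j where j: "{h1, h2} = {j, (j + 1) mod n}" "j < n"
        by (auto simp: cycle_graph_def)
      have "e = (\<lambda>h. (g1, h)) ` {h1, h2}"
        using e \<open>g1 = g2\<close> by auto
      also have "\<dots> = {(g1, j), (g1, (j + 1) mod n)}"
        unfolding j(1) by simp
      also have "\<dots> = vedge ?p (int g1) (int j)"
        using suc[of n "int j"] j(2) V(1) by (simp add: vedge_def)
      finally show ?thesis
        by blast
    next
      assume "h1 = h2" "{g1, g2} \<in> edges (cycle_graph m)"
      then obtain i where i: "{g1, g2} = {i, (i + 1) mod m}" "i < m"
        by (auto simp: cycle_graph_def)
      have "e = (\<lambda>g. (g, h1)) ` {g1, g2}"
        using e \<open>h1 = h2\<close> by auto
      also have "\<dots> = {(i, h1), ((i + 1) mod m, h1)}"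
        unfolding i(1) by simp
      also have "\<dots> = hedge ?p (int i) (int h1)"
        using suc[of m "int i"] i(2) V(3) by (simp add: hedge_def)
      finally show ?thesis
        by blast
    qed
  next
    fix e assume "e \<in> hedges ?p \<union> vedges ?p"
    then show "e \<in> edges ?G"
    proof (elim UnE)
      assume "e \<in> hedges ?p"
      then obtain i j where e: "e = hedge ?p i j"
        by blast
      have edge: "{nat (i mod int m), nat ((i + 1) mod int m)} \<in> edges (cycle_graph m)"
        using suc[of m i] lt(1)[of i] assms by (auto simp: cycle_graph_def)
      have in_verts: "nat (x mod int m) \<in> verts (cycle_graph m)" "nat (y mod int n) \<in> verts (cycle_graph n)" for x y
        using lt by (simp_all add: cycle_graph_def)
      show ?thesis
        unfolding e hedge_def by (intro product_edge_left edge in_verts)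
    next
      assume "e \<in> vedges ?p"
      then obtain i j where e: "e = vedge ?p i j"
        by blast
      have edge: "{nat (j mod int n), nat ((j + 1) mod int n)} \<in> edges (cycle_graph n)"
        using suc[of n j] lt(2)[of j] assms by (auto simp: cycle_graph_def)
      have in_verts: "nat (x mod int m) \<in> verts (cycle_graph m)" "nat (y mod int n) \<in> verts (cycle_graph n)" for x y
        using lt by (simp_all add: cycle_graph_def)
      show ?thesis
        unfolding e vedge_def by (intro product_edge_right edge in_verts)
    qed
  qed
qed

theorem theorem4p9:
  fixes m n d :: nat
  assumes "m \<ge> 3" and "n \<ge> 3"
  shows
    "(m \<ge> 4 \<and> even m \<and> n \<ge> 4 \<and> even n \<longrightarrow>
        (1 \<le> d \<and> d \<le> m * n div 2 \<longrightarrow> tau d (cycle_graph m \<box> cycle_graph n) = 4 * d)) \<and>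
     (m \<ge> 4 \<and> even m \<and> n \<ge> 3 \<and> odd n \<longrightarrow>
        (1 \<le> d \<and> d \<le> m * n div 2 \<longrightarrow> tau d (cycle_graph m \<box> cycle_graph n) = 4 * d)) \<and>
     (m \<ge> 3 \<and> odd m \<and> n \<ge> 3 \<and> odd n \<and> m \<ge> n \<longrightarrow>
        (m \<ge> 5 \<and> n \<ge> 3 \<longrightarrow> tau 1 (cycle_graph m \<box> cycle_graph n) = 7) \<and>
        (m \<ge> 7 \<and> n \<ge> 3 \<longrightarrow>
          (2 \<le> d \<and> d \<le> (m - 3) div 2 \<longrightarrow>
             4 * d + 2 \<le> tau d (cycle_graph m \<box> cycle_graph n) \<and>
             tau d (cycle_graph m \<box> cycle_graph n) \<le> 5 * d + 2)) \<and>
        (m \<ge> 3 \<and> n \<ge> 3 \<longrightarrow>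
          ((m - 1) div 2 \<le> d \<and> d \<le> (m * n - 1) div 2 \<longrightarrow>
             tau d (cycle_graph m \<box> cycle_graph n) = 4 * d + 2)))"
proof -
  interpret torus "cycle_graph m \<box> cycle_graph n" "int m" "int n"
      "\<lambda>i j. (nat (i mod int m), nat (j mod int n))"
    by (rule torus_cycle_product[OF assms])
  have area: "nat (int m * int n) = m * n" "nat (int m) * nat (int n div 2) = m * (n div 2)"
    by (simp_all add: nat_mult_distrib nat_div_distrib)
  have even_case: "tau d (cycle_graph m \<box> cycle_graph n) = 4 * d" if "even m" "d \<le> m * n div 2"
    using tau_even[of d] that unfolding area by simp
  have one: "tau 1 (cycle_graph m \<box> cycle_graph n) = 7" if "odd m" "odd n" "5 \<le> m"
    using tau_odd_1 that by simp
  have half: "m * (n div 2) + (m - 1) div 2 = m * n div 2" if parity: "odd m" "odd n"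
  proof -
    obtain a b where "m = 2 * a + 1" "n = 2 * b + 1"
      using parity by (meson oddE)
    moreover from this have "m * n = 2 * (m * b + a) + 1"
      by (simp add: algebra_simps)
    ultimately show ?thesis
      by simp
  qed
  have small: "4 * d + 2 \<le> tau d (cycle_graph m \<box> cycle_graph n) \<and>
      tau d (cycle_graph m \<box> cycle_graph n) \<le> 5 * d + 2"
    if "odd m" "odd n" "n \<le> m" "2 \<le> d" "d \<le> (m - 3) div 2"
  proof -
    have "1 \<le> n div 2"
      using assms(2) by linarith
    then have "m \<le> m * (n div 2)"
      by simp
    then have "d + 1 \<le> m * (n div 2)"
      using that(4,5) by linarith
    then show ?thesis
      using tau_odd_small[of d] that unfolding area by simp
  qed
  have large: "tau d (cycle_graph m \<box> cycle_graph n) = 4 * d + 2"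
    if "odd m" "odd n" "n \<le> m" "(m - 1) div 2 \<le> d" "d \<le> (m * n - 1) div 2"
  proof -
    have "1 \<le> d"
      using assms(1) that(4) by linarith
    moreover have "d \<le> m * n div 2"
      using that(5) by (meson diff_le_self div_le_mono order_trans)
    moreover have "m * n div 2 \<le> d + m * (n div 2)"
      using half[OF that(1,2)] that(4) by linarith
    ultimately show ?thesis
      using tau_odd_large[of d] that unfolding area by simp
  qed
  show ?thesis
    using even_case one small large by blast
qed

end
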